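(* Let $u:(M,g)\to(N,h)$ be a smooth map between Riemannian manifolds and let $S_{\Phi_{F,u}}$ be the associated stress-energy tensor. Then for all $x\in M$ and each vector $X\in T_xM$, $$(\mathrm{div}\,S_{\Phi_{F,u}})(X)=-\langle \mathrm{div}_g\sigma_{F,u},du(X)\rangle_h ,$$ where $\sigma_{F,u}(X)=F'\left(\frac{\|u^*h\|^2}{4}\right)\sum_{i=1}^m\langle du(X),du(e_i)\rangle_h\,du(e_i)$.
   Context: $F:[0,+\infty)\to[0,+\infty)$ is a $C^2$ function with $F(0)=0$ and $F'>0$ on $(0,+\infty)$. $(M,g)$ has dimension $m$; $\{e_i\}_{i=1}^m$ denotes a local orthonormal frame on $M$. $\|u^*h\|^2=\sum_{i,j=1}^m\langle du(e_i),du(e_j)\rangle_h^2$ and $\sigma_u(Y)=\sum_{j=1}^m\langle du(Y),du(e_j)\rangle_h\,du(e_j)$. The stress-energy tensor of $u$ is the symmetric 2-tensor $S_{\Phi_{F,u}}(X,Y)=F\left(\frac{\|u^*h\|^2}{4}\right)\langle X,Y\rangle_g-F'\left(\frac{\|u^*h\|^2}{4}\right)\langle\sigma_u(X),du(Y)\rangle_h$, and its divergence is $(\mathrm{div}\,S)(X)=\sum_{k=1}^m(\nabla_{e_k}S)(e_k,X)$, with $\nabla$ the Levi-Civita connection of $M$. With $\tilde\nabla$ the connection on $u^{-1}TN$ induced by the Levi-Civita connection of $N$, $\mathrm{div}_g\sigma_{F,u}=\sum_{i=1}^m\left\{\tilde\nabla_{e_i}(\sigma_{F,u}(e_i))-\sigma_{F,u}(\nabla_{e_i}e_i)\right\}$.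 *)

theory Defs
  imports "HOL-Analysis.Analysis"
begin

text \<open>C-infinity maps on an open subset S of a Euclidean space: all iterated directional
  derivatives exist and are differentiable on S.\<close>

primrec Ck_on ::
  "nat \<Rightarrow> ('a::euclidean_space \<Rightarrow> 'b::real_normed_vector) \<Rightarrow> 'a set \<Rightarrow> bool" where
  "Ck_on 0 f S \<longleftrightarrow> continuous_on S f"
| "Ck_on (Suc k) f S \<longleftrightarrow> (\<forall>x\<in>S. f differentiable (at x)) \<and>
     (\<forall>v. Ck_on k (\<lambda>x. frechet_derivative f (at x) v) S)"

definition smooth_on ::
  "('a::euclidean_space \<Rightarrow> 'b::real_normed_vector) \<Rightarrow> 'a set \<Rightarrow> bool" where
  "smooth_on f S \<longleftrightarrow> (\<forall>k. Ck_on k f S)"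

text \<open>The points of a manifold are the elements of the type \<open>'p\<close>, which carries its topology;
  the model space is \<open>'e\<close>, so the dimension is \<open>DIM('e)\<close>. A chart is a pair of its domain and
  its coordinate map; the values of the coordinate map off the domain are irrelevant.\<close>

type_synonym ('p, 'e) chart = "'p set \<times> ('p \<Rightarrow> 'e)"

definition chart_inv :: "('p, 'e) chart \<Rightarrow> 'e \<Rightarrow> 'p" where
  "chart_inv c = inv_into (fst c) (snd c)"

definition charts_at :: "('p, 'e) chart set \<Rightarrow> 'p \<Rightarrow> ('p, 'e) chart set" where
  "charts_at A p = {c \<in> A. p \<in> fst c}"

definition smooth_manifold ::
  "('p::{t2_space, second_countable_topology}, 'e::euclidean_space) chart set \<Rightarrow> bool" where
  "smooth_manifold A \<longleftrightarrow>
     (\<forall>c\<in>A. open (fst c) \<and> open (snd c ` fst c) \<and>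
        homeomorphism (fst c) (snd c ` fst c) (snd c) (chart_inv c)) \<and>
     (\<Union>c\<in>A. fst c) = UNIV \<and>
     (\<forall>c\<in>A. \<forall>c'\<in>A. smooth_on (snd c' \<circ> chart_inv c) (snd c ` (fst c \<inter> fst c')))"

definition smooth_map ::
  "('p::topological_space, 'e::euclidean_space) chart set \<Rightarrow>
   ('q::topological_space, 'f::euclidean_space) chart set \<Rightarrow> ('p \<Rightarrow> 'q) \<Rightarrow> bool" where
  "smooth_map A B u \<longleftrightarrow> continuous_on UNIV u \<and>
     (\<forall>c\<in>A. \<forall>d\<in>B. smooth_on (snd d \<circ> u \<circ> chart_inv c) (snd c ` (fst c \<inter> u -` fst d)))"

text \<open>A tangent vector at p is the family of its components in the charts around p, related to
  one another by the derivatives of the coordinate changes (and zero, by convention, at all other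
  arguments, so that equality of tangent vectors is equality of functions). The vector space
  operations are pointwise.\<close>

type_synonym ('p, 'e) tvec = "('p, 'e) chart \<Rightarrow> 'e"

definition tangent_space ::
  "('p, 'e::euclidean_space) chart set \<Rightarrow> 'p \<Rightarrow> ('p, 'e) tvec set" where
  "tangent_space A p = {v.
     (\<forall>c\<in>charts_at A p. \<forall>c'\<in>charts_at A p.
        v c' = frechet_derivative (snd c' \<circ> chart_inv c) (at (snd c p)) (v c)) \<and>
     (\<forall>c. c \<notin> charts_at A p \<longrightarrow> v c = 0)}"

text \<open>The derivative v(f) of a vector-valued function f in direction v, for v tangent at p. By the
  chain rule, the value computed in a chart does not depend on the chart.\<close>

definition dir_deriv ::
  "('p, 'e::euclidean_space) chart set \<Rightarrow> 'p \<Rightarrow> ('p, 'e) tvec \<Rightarrow>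
   ('p \<Rightarrow> 'b::real_normed_vector) \<Rightarrow> 'b" where
  "dir_deriv A p v f = (THE r. \<forall>c\<in>charts_at A p.
     r = frechet_derivative (f \<circ> chart_inv c) (at (snd c p)) (v c))"

text \<open>The differential du, at p: its component in a chart d around u(p) is v(d o u).\<close>

definition differential ::
  "('p, 'e::euclidean_space) chart set \<Rightarrow> ('q, 'f::euclidean_space) chart set \<Rightarrow>
   ('p \<Rightarrow> 'q) \<Rightarrow> 'p \<Rightarrow> ('p, 'e) tvec \<Rightarrow> ('q, 'f) tvec" where
  "differential A B u p v =
     (\<lambda>d. if d \<in> charts_at B (u p) then dir_deriv A p v (snd d \<circ> u) else 0)"

definition smooth_field ::
  "('p::topological_space, 'e::euclidean_space) chart set \<Rightarrow> 'p set \<Rightarrow>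
   ('p \<Rightarrow> ('p, 'e) tvec) \<Rightarrow> bool" where
  "smooth_field A U W \<longleftrightarrow> open U \<and> (\<forall>q\<in>U. W q \<in> tangent_space A q) \<and>
     (\<forall>c\<in>A. smooth_on (\<lambda>y. W (chart_inv c y) c) (snd c ` (fst c \<inter> U)))"

text \<open>The coordinate field of the chart c with constant component a in c; for a basis vector a
  this is a coordinate vector field.\<close>

definition coord_field ::
  "('p, 'e::euclidean_space) chart set \<Rightarrow> ('p, 'e) chart \<Rightarrow> 'e \<Rightarrow> 'p \<Rightarrow> ('p, 'e) tvec" where
  "coord_field A c a p = (\<lambda>c'. if c \<in> charts_at A p \<and> c' \<in> charts_at A p
     then frechet_derivative (snd c' \<circ> chart_inv c) (at (snd c p)) a else 0)"

definition riemannian_metric ::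
  "('p, 'e::euclidean_space) chart set \<Rightarrow>
   ('p \<Rightarrow> ('p, 'e) tvec \<Rightarrow> ('p, 'e) tvec \<Rightarrow> real) \<Rightarrow> bool" where
  "riemannian_metric A g \<longleftrightarrow>
     (\<forall>p. \<forall>v\<in>tangent_space A p. \<forall>w\<in>tangent_space A p.
        g p v w = g p w v \<and> (v \<noteq> (\<lambda>c. 0) \<longrightarrow> g p v v > 0) \<and>
        (\<forall>z\<in>tangent_space A p. \<forall>r. g p (\<lambda>c. r *\<^sub>R v c + w c) z = r * g p v z + g p w z)) \<and>
     (\<forall>c\<in>A. \<forall>a b. smooth_on
        (\<lambda>y. g (chart_inv c y) (coord_field A c a (chart_inv c y)) (coord_field A c b (chart_inv c y)))
        (snd c ` fst c))"

text \<open>The coefficients at p, in the chart c, of the Levi-Civita connection, as the bilinear map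
  taking (k, a) to the components of the covariant derivative of the coordinate field a in
  direction k. Coordinate fields commute, so vanishing torsion is symmetry; the second condition
  is compatibility with the metric.\<close>

definition levi_civita ::
  "('p, 'e::euclidean_space) chart set \<Rightarrow> ('p \<Rightarrow> ('p, 'e) tvec \<Rightarrow> ('p, 'e) tvec \<Rightarrow> real) \<Rightarrow>
   ('p, 'e) chart \<Rightarrow> 'p \<Rightarrow> 'e \<Rightarrow> 'e \<Rightarrow> 'e" where
  "levi_civita A g c p = (THE \<Gamma>. bilinear \<Gamma> \<and> (\<forall>a b. \<Gamma> a b = \<Gamma> b a) \<and>
     (\<forall>k a b. dir_deriv A p (coord_field A c k p)
                 (\<lambda>q. g q (coord_field A c a q) (coord_field A c b q)) =
        g p (coord_field A c (\<Gamma> k a) p) (coord_field A c b p) +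
        g p (coord_field A c a p) (coord_field A c (\<Gamma> k b) p)))"

definition nabla ::
  "('p, 'e::euclidean_space) chart set \<Rightarrow> ('p \<Rightarrow> ('p, 'e) tvec \<Rightarrow> ('p, 'e) tvec \<Rightarrow> real) \<Rightarrow>
   'p \<Rightarrow> ('p, 'e) tvec \<Rightarrow> ('p \<Rightarrow> ('p, 'e) tvec) \<Rightarrow> ('p, 'e) tvec" where
  "nabla A g p v W = (\<lambda>c. if c \<in> charts_at A p
     then dir_deriv A p v (\<lambda>q. W q c) + levi_civita A g c p (v c) (W p c) else 0)"

text \<open>The connection on the pull-back bundle induced by the Levi-Civita connection of the target
  (B, h), for V a section along u.\<close>

definition nabla_along ::
  "('p, 'e::euclidean_space) chart set \<Rightarrow> ('q, 'f::euclidean_space) chart set \<Rightarrow>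
   ('q \<Rightarrow> ('q, 'f) tvec \<Rightarrow> ('q, 'f) tvec \<Rightarrow> real) \<Rightarrow> ('p \<Rightarrow> 'q) \<Rightarrow>
   'p \<Rightarrow> ('p, 'e) tvec \<Rightarrow> ('p \<Rightarrow> ('q, 'f) tvec) \<Rightarrow> ('q, 'f) tvec" where
  "nabla_along A B h u p v V = (\<lambda>d. if d \<in> charts_at B (u p)
     then dir_deriv A p v (\<lambda>q. V q d) +
          levi_civita B h d (u p) (differential A B u p v d) (V p d) else 0)"

text \<open>The covariant derivative, in direction v, of a 2-tensor T at (w, z). It is computed with
  smooth fields extending w and z and does not depend on the extension.\<close>

definition nabla_tensor ::
  "('p::topological_space, 'e::euclidean_space) chart set \<Rightarrow>
   ('p \<Rightarrow> ('p, 'e) tvec \<Rightarrow> ('p, 'e) tvec \<Rightarrow> real) \<Rightarrow>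
   ('p \<Rightarrow> ('p, 'e) tvec \<Rightarrow> ('p, 'e) tvec \<Rightarrow> real) \<Rightarrow>
   'p \<Rightarrow> ('p, 'e) tvec \<Rightarrow> ('p, 'e) tvec \<Rightarrow> ('p, 'e) tvec \<Rightarrow> real" where
  "nabla_tensor A g T p v w z = (THE r. \<forall>U W Z.
     p \<in> U \<and> smooth_field A U W \<and> smooth_field A U Z \<and> W p = w \<and> Z p = z \<longrightarrow>
     r = dir_deriv A p v (\<lambda>q. T q (W q) (Z q)) - T p (nabla A g p v W) z - T p w (nabla A g p v Z))"

text \<open>In the following, \<open>e 1, \<dots>, e m\<close> is a local orthonormal frame of (A, g).\<close>

definition orthonormal_frame ::
  "('p::topological_space, 'e::euclidean_space) chart set \<Rightarrow>
   ('p \<Rightarrow> ('p, 'e) tvec \<Rightarrow> ('p, 'e) tvec \<Rightarrow> real) \<Rightarrow>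
   'p set \<Rightarrow> (nat \<Rightarrow> 'p \<Rightarrow> ('p, 'e) tvec) \<Rightarrow> bool" where
  "orthonormal_frame A g U e \<longleftrightarrow>
     (\<forall>i\<in>{1..DIM('e)}. smooth_field A U (e i)) \<and>
     (\<forall>q\<in>U. \<forall>i\<in>{1..DIM('e)}. \<forall>j\<in>{1..DIM('e)}. g q (e i q) (e j q) = (if i = j then 1 else 0))"

definition divergence ::
  "('p::topological_space, 'e::euclidean_space) chart set \<Rightarrow>
   ('p \<Rightarrow> ('p, 'e) tvec \<Rightarrow> ('p, 'e) tvec \<Rightarrow> real) \<Rightarrow> (nat \<Rightarrow> 'p \<Rightarrow> ('p, 'e) tvec) \<Rightarrow>
   ('p \<Rightarrow> ('p, 'e) tvec \<Rightarrow> ('p, 'e) tvec \<Rightarrow> real) \<Rightarrow> 'p \<Rightarrow> ('p, 'e) tvec \<Rightarrow> real" where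
  "divergence A g e T p X = (\<Sum>k=1..DIM('e). nabla_tensor A g T p (e k p) (e k p) X)"

definition pullback_norm2 ::
  "('p, 'e::euclidean_space) chart set \<Rightarrow> ('q, 'f::euclidean_space) chart set \<Rightarrow>
   ('q \<Rightarrow> ('q, 'f) tvec \<Rightarrow> ('q, 'f) tvec \<Rightarrow> real) \<Rightarrow> ('p \<Rightarrow> 'q) \<Rightarrow>
   (nat \<Rightarrow> 'p \<Rightarrow> ('p, 'e) tvec) \<Rightarrow> 'p \<Rightarrow> real" where
  "pullback_norm2 A B h u e p = (\<Sum>i=1..DIM('e). \<Sum>j=1..DIM('e).
     (h (u p) (differential A B u p (e i p)) (differential A B u p (e j p)))\<^sup>2)"

definition sigma ::
  "('p, 'e::euclidean_space) chart set \<Rightarrow> ('q, 'f::euclidean_space) chart set \<Rightarrow>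
   ('q \<Rightarrow> ('q, 'f) tvec \<Rightarrow> ('q, 'f) tvec \<Rightarrow> real) \<Rightarrow> ('p \<Rightarrow> 'q) \<Rightarrow>
   (nat \<Rightarrow> 'p \<Rightarrow> ('p, 'e) tvec) \<Rightarrow> 'p \<Rightarrow> ('p, 'e) tvec \<Rightarrow> ('q, 'f) tvec" where
  "sigma A B h u e p Y = (\<lambda>d. \<Sum>j=1..DIM('e).
     h (u p) (differential A B u p Y) (differential A B u p (e j p)) *\<^sub>R
       differential A B u p (e j p) d)"

definition sigma_F ::
  "('p, 'e::euclidean_space) chart set \<Rightarrow> ('q, 'f::euclidean_space) chart set \<Rightarrow>
   ('q \<Rightarrow> ('q, 'f) tvec \<Rightarrow> ('q, 'f) tvec \<Rightarrow> real) \<Rightarrow> ('p \<Rightarrow> 'q) \<Rightarrow>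
   (nat \<Rightarrow> 'p \<Rightarrow> ('p, 'e) tvec) \<Rightarrow> (real \<Rightarrow> real) \<Rightarrow> 'p \<Rightarrow> ('p, 'e) tvec \<Rightarrow> ('q, 'f) tvec" where
  "sigma_F A B h u e F' p X =
     (\<lambda>d. F' (pullback_norm2 A B h u e p / 4) *\<^sub>R sigma A B h u e p X d)"

definition stress_energy ::
  "('p, 'e::euclidean_space) chart set \<Rightarrow> ('q, 'f::euclidean_space) chart set \<Rightarrow>
   ('p \<Rightarrow> ('p, 'e) tvec \<Rightarrow> ('p, 'e) tvec \<Rightarrow> real) \<Rightarrow>
   ('q \<Rightarrow> ('q, 'f) tvec \<Rightarrow> ('q, 'f) tvec \<Rightarrow> real) \<Rightarrow> ('p \<Rightarrow> 'q) \<Rightarrow>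
   (nat \<Rightarrow> 'p \<Rightarrow> ('p, 'e) tvec) \<Rightarrow> (real \<Rightarrow> real) \<Rightarrow> (real \<Rightarrow> real) \<Rightarrow>
   'p \<Rightarrow> ('p, 'e) tvec \<Rightarrow> ('p, 'e) tvec \<Rightarrow> real" where
  "stress_energy A B g h u e F F' p X Y =
     F (pullback_norm2 A B h u e p / 4) * g p X Y -
     F' (pullback_norm2 A B h u e p / 4) * h (u p) (sigma A B h u e p X) (differential A B u p Y)"

definition div_sigma_F ::
  "('p, 'e::euclidean_space) chart set \<Rightarrow> ('q, 'f::euclidean_space) chart set \<Rightarrow>
   ('p \<Rightarrow> ('p, 'e) tvec \<Rightarrow> ('p, 'e) tvec \<Rightarrow> real) \<Rightarrow>
   ('q \<Rightarrow> ('q, 'f) tvec \<Rightarrow> ('q, 'f) tvec \<Rightarrow> real) \<Rightarrow> ('p \<Rightarrow> 'q) \<Rightarrow>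
   (nat \<Rightarrow> 'p \<Rightarrow> ('p, 'e) tvec) \<Rightarrow> (real \<Rightarrow> real) \<Rightarrow> 'p \<Rightarrow> ('q, 'f) tvec" where
  "div_sigma_F A B g h u e F' p = (\<lambda>d. \<Sum>i=1..DIM('e).
     nabla_along A B h u p (e i p) (\<lambda>q. sigma_F A B h u e F' q (e i q)) d -
     sigma_F A B h u e F' p (nabla A g p (e i p) (e i)) d)"

end

theory Submission
  imports Defs
begin

text \<open>
  For a smooth field W, \<open>\<nabla>\<^sub>v(du(W)) = du(\<nabla>\<^sub>v W) + (\<nabla>du)(v, W)\<close>, where \<open>\<nabla>du\<close> is symmetric and depends only
  on the values of its arguments. Together with the compatibility of both connections with the
  metrics, this expresses \<open>\<nabla>\<^sub>v S\<close> by pointwise quantities. Writing \<open>E\<^sub>i = du(e\<^sub>i)\<close> and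
  \<open>h\<^sub>i\<^sub>j = \<langle>E\<^sub>i, E\<^sub>j\<rangle>\<close>, the terms of \<open>(div S)(X)\<close> and \<open>-\<langle>div \<sigma>\<^sub>F, du(X)\<rangle>\<close> cancel in pairs, except for
  \<open>X(F(\<parallel>u\<^sup>*h\<parallel>\<^sup>2/4))\<close> against \<open>F' \<Sum> h\<^sub>i\<^sub>j \<langle>E\<^sub>j, (\<nabla>du)(e\<^sub>i, X)\<rangle>\<close>. These two agree because the remaining
  contribution \<open>\<Sum> \<langle>\<nabla>\<^sub>X e\<^sub>i, e\<^sub>l\<rangle> h\<^sub>i\<^sub>j h\<^sub>l\<^sub>j\<close> pairs an antisymmetric with a symmetric matrix.
\<close>

section \<open>Calculus in Euclidean space\<close>

text \<open>Directional derivatives, Christoffel symbols and the covariant derivative of a tensor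
  are definite descriptions, so each must be shown to exist and to be unique before it can be
  computed with. For directional derivatives this is the chain rule; for Christoffel symbols it is
  linear algebra with the metric in one chart. For the tensor derivative, independence of the
  extending fields gives existence, and an actual extension gives uniqueness; extensions are
  combinations of the frame with constant coefficients. Equality of mixed second derivatives serves
  twice: for the Hessian of \<open>u\<close> in coordinates, and for coordinate changes, where it
  yields the transformation law that makes covariant derivatives tangent vectors. \<open>F\<close>
  and \<open>F'\<close> are differentiable only within the closed half-line, so their composites
  with the norm are differentiated by using that the norm never leaves it. The derivative of
  \<open>F'\<close> along the frame is never evaluated: it enters both sides with the same
  factors.\<close>

lemma smooth_on_differentiable:
  "smooth_on f S \<Longrightarrow> x \<in> S \<Longrightarrow> f differentiable (at x)"
  unfolding smooth_on_def by (metis Ck_on.simps(2))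

lemma smooth_on_has_derivative:
  "smooth_on f S \<Longrightarrow> x \<in> S \<Longrightarrow> (f has_derivative frechet_derivative f (at x)) (at x)"
  using smooth_on_differentiable frechet_derivative_works by blast

lemma smooth_on_frechet_derivative:
  "smooth_on f S \<Longrightarrow> smooth_on (\<lambda>x. frechet_derivative f (at x) v) S"
  unfolding smooth_on_def by (metis Ck_on.simps(2))

lemma smooth_on_continuous: "smooth_on f S \<Longrightarrow> continuous_on S f"
  unfolding smooth_on_def by (metis Ck_on.simps(1))

lemma frechet_derivative_eqI:
  "(f has_derivative f') (at x) \<Longrightarrow> frechet_derivative f (at x) = f'"
  by (metis frechet_derivative_at)

lemma frechet_derivative_cong_open:
  assumes "open S" "x \<in> S" "\<And>y. y \<in> S \<Longrightarrow> f y = g y"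
  shows "frechet_derivative f (at x) = frechet_derivative g (at x)"
proof -
  have "(f has_derivative f') (at x) \<longleftrightarrow> (g has_derivative f') (at x)" for f'
    using assms has_derivative_transform_within_open[of f f' x UNIV S g]
      has_derivative_transform_within_open[of g f' x UNIV S f] by auto
  then show ?thesis unfolding frechet_derivative_def by simp
qed

lemma differentiable_cong_open:
  assumes "open S" "x \<in> S" "\<And>y. y \<in> S \<Longrightarrow> f y = g y"
  shows "f differentiable (at x) \<longleftrightarrow> g differentiable (at x)"
  using assms has_derivative_transform_within_open[of f _ x UNIV S g]
      has_derivative_transform_within_open[of g _ x UNIV S f] unfolding differentiable_def by metis

text \<open>Derivatives in \<open>Ck_on\<close> are taken in the whole space, so agreement of values
  passes to derivatives only because \<open>S\<close> is open. Both functions vary in the induction,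
  which descends to their derivatives.\<close>

lemma Ck_on_cong_open:
  assumes "open S" "\<And>y. y \<in> S \<Longrightarrow> f y = g y" "Ck_on k f S"
  shows "Ck_on k g S"
  using assms(2,3)
proof (induction k arbitrary: f g)
  case 0
  then show ?case using continuous_on_cong by (metis Ck_on.simps(1))
next
  case (Suc k)
  have "g differentiable (at x)" if "x \<in> S" for x
    using differentiable_cong_open[of S x f g] assms(1) Suc.prems that by simp
  moreover have "Ck_on k (\<lambda>x. frechet_derivative g (at x) v) S" for v
  proof (rule Suc.IH)
    show "Ck_on k (\<lambda>x. frechet_derivative f (at x) v) S" using Suc.prems(2) by simp
    show "frechet_derivative f (at y) v = frechet_derivative g (at y) v" if "y \<in> S" for y
      using frechet_derivative_cong_open[OF assms(1) that Suc.prems(1)] by simp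
  qed
  ultimately show ?case by simp
qed

text \<open>Constant coefficients are all that extending a single tangent vector by frame fields
  requires, and they make the induction close: the derivative is a combination with the same
  coefficients.\<close>

lemma smooth_on_linear_combination:
  fixes f :: "'i \<Rightarrow> 'a::euclidean_space \<Rightarrow> 'b::real_normed_vector"
  assumes "open S" "\<And>i. i \<in> I \<Longrightarrow> smooth_on (f i) S"
  shows "smooth_on (\<lambda>x. \<Sum>i\<in>I. r i *\<^sub>R f i x) S"
  unfolding smooth_on_def
proof
  fix k
  show "Ck_on k (\<lambda>x. \<Sum>i\<in>I. r i *\<^sub>R f i x) S"
    using assms(2)
  proof (induction k arbitrary: f)
    case 0
    then have "continuous_on S (f i)" if "i \<in> I" for i using that smooth_on_continuous by blast
    then show ?case by (auto intro!: continuous_on_sum continuous_on_scaleR)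
  next
    case (Suc k)
    have D: "((\<lambda>x. \<Sum>i\<in>I. r i *\<^sub>R f i x) has_derivative
        (\<lambda>v. \<Sum>i\<in>I. r i *\<^sub>R frechet_derivative (f i) (at x) v)) (at x)" if "x \<in> S" for x
      using Suc.prems that
      by (auto intro!: derivative_eq_intros has_derivative_sum has_derivative_scaleR_right smooth_on_has_derivative)
    have "Ck_on k (\<lambda>x. \<Sum>i\<in>I. r i *\<^sub>R frechet_derivative (f i) (at x) v) S" for v
      by (rule Suc.IH) (simp add: Suc.prems smooth_on_frechet_derivative)
    then have "Ck_on k (\<lambda>x. frechet_derivative (\<lambda>x. \<Sum>i\<in>I. r i *\<^sub>R f i x) (at x) v) S" for v
      by (rule Ck_on_cong_open[OF assms(1), rotated]) (simp add: frechet_derivative_eqI[OF D])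
    then show ?case using D by (auto simp: differentiable_def)
  qed
qed

text \<open>The mean value theorem is used twice: in direction \<open>a\<close> for the difference
  of \<open>f\<close> across a step along \<open>b\<close>, then in direction \<open>b\<close> for
  the derivative so obtained. The left side is symmetric in \<open>a\<close> and \<open>b\<close>,
  which makes the two orders of differentiation comparable.\<close>

lemma second_difference:
  fixes f :: "'a::euclidean_space \<Rightarrow> real"
  assumes f: "\<And>y. y \<in> S \<Longrightarrow> f differentiable (at y)"
    and fa: "\<And>y. y \<in> S \<Longrightarrow> (\<lambda>y. frechet_derivative f (at y) a) differentiable (at y)"
    and t: "t > 0" and S: "\<And>s r. s \<in> {0..t} \<Longrightarrow> r \<in> {0..t} \<Longrightarrow> x + s *\<^sub>R a + r *\<^sub>R b \<in> S"
  shows "\<exists>s\<in>{0..t}. \<exists>r\<in>{0..t}. f (x + t *\<^sub>R a + t *\<^sub>R b) - f (x + t *\<^sub>R b) - f (x + t *\<^sub>R a) + f x =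
    t * (t * frechet_derivative (\<lambda>y. frechet_derivative f (at y) a) (at (x + s *\<^sub>R a + r *\<^sub>R b)) b)"
proof -
  define fa where "fa = (\<lambda>y. frechet_derivative f (at y) a)"
  have D: "((\<lambda>s. F (z + s *\<^sub>R v)) has_real_derivative frechet_derivative F (at (z + s *\<^sub>R v)) v) (at s)"
    if "F differentiable (at (z + s *\<^sub>R v))" for F :: "'a \<Rightarrow> real" and z s v
  proof -
    have F: "(F has_derivative frechet_derivative F (at (z + s *\<^sub>R v))) (at (z + s *\<^sub>R v))"
      using that frechet_derivative_works by blast
    have "((\<lambda>s. F (z + s *\<^sub>R v)) has_derivative
        (\<lambda>h. frechet_derivative F (at (z + s *\<^sub>R v)) (h *\<^sub>R v))) (at s)"
      by (rule has_derivative_compose[of "\<lambda>s. z + s *\<^sub>R v" "\<lambda>h. h *\<^sub>R v" s UNIV F, OF _ F])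
        (auto intro!: derivative_eq_intros)
    moreover have "frechet_derivative F (at (z + s *\<^sub>R v)) (h *\<^sub>R v)
        = frechet_derivative F (at (z + s *\<^sub>R v)) v * h" for h
      using linear_frechet_derivative[OF that] by (simp add: linear_cmul)
    ultimately show ?thesis by (simp add: has_field_derivative_def)
  qed
  let ?g = "\<lambda>s. f ((x + t *\<^sub>R b) + s *\<^sub>R a) - f (x + s *\<^sub>R a)"
  have "\<exists>s>0. s < t \<and> ?g t - ?g 0 = (t - 0) * (fa (x + t *\<^sub>R b + s *\<^sub>R a) - fa (x + s *\<^sub>R a))"
  proof (rule MVT2[OF t])
    fix s assume "0 \<le> s" "s \<le> t"
    then show "(?g has_real_derivative fa (x + t *\<^sub>R b + s *\<^sub>R a) - fa (x + s *\<^sub>R a)) (at s)"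
      unfolding fa_def using S[of s t] S[of s 0] t
      by (intro DERIV_diff D f) (auto simp: algebra_simps)
  qed
  then obtain s where s: "0 < s" "s < t"
    and 1: "?g t - ?g 0 = t * (fa (x + t *\<^sub>R b + s *\<^sub>R a) - fa (x + s *\<^sub>R a))" by auto
  let ?k = "\<lambda>r. fa ((x + s *\<^sub>R a) + r *\<^sub>R b)"
  have "\<exists>r>0. r < t \<and> ?k t - ?k 0 = (t - 0) * frechet_derivative fa (at (x + s *\<^sub>R a + r *\<^sub>R b)) b"
  proof (rule MVT2[OF t])
    fix r assume "0 \<le> r" "r \<le> t"
    then show "(?k has_real_derivative frechet_derivative fa (at (x + s *\<^sub>R a + r *\<^sub>R b)) b) (at r)"
      using s S[of s r] fa unfolding fa_def by (intro D) auto
  qed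
  then obtain r where r: "0 < r" "r < t"
    and 2: "?k t - ?k 0 = t * frechet_derivative fa (at (x + s *\<^sub>R a + r *\<^sub>R b)) b" by auto
  have "f (x + t *\<^sub>R a + t *\<^sub>R b) - f (x + t *\<^sub>R b) - f (x + t *\<^sub>R a) + f x = ?g t - ?g 0"
    by (simp add: algebra_simps)
  also have "\<dots> = t * (?k t - ?k 0)" unfolding 1 by (simp add: algebra_simps)
  finally show ?thesis unfolding 2 using s r unfolding fa_def
    by (intro bexI[of _ s] bexI[of _ r]) auto
qed

text \<open>Schwarz's theorem. The two mixed derivatives, at intermediate points of one small
  parallelogram, come from the same second difference and hence coincide there; continuity at
  \<open>x\<close> then leaves no room for a gap.\<close>

lemma second_derivative_symmetric_real:
  fixes f :: "'a::euclidean_space \<Rightarrow> real"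
  assumes f: "smooth_on f S" and S: "open S" "x \<in> S"
  shows "frechet_derivative (\<lambda>y. frechet_derivative f (at y) a) (at x) b =
    frechet_derivative (\<lambda>y. frechet_derivative f (at y) b) (at x) a"
proof (rule ccontr)
  define D where "D = (\<lambda>a b y. frechet_derivative (\<lambda>y. frechet_derivative f (at y) a) (at y) b)"
  assume "\<not> ?thesis"
  then have ne: "D a b x \<noteq> D b a x" unfolding D_def by simp
  \<comment> \<open>Half of the assumed gap, so two values cannot both be within
    \<open>\<epsilon>\<close> of a common number.\<close>
  define \<epsilon> where "\<epsilon> = \<bar>D a b x - D b a x\<bar> / 2"
  have \<epsilon>: "\<epsilon> > 0" using ne unfolding \<epsilon>_def by simp
  have cont: "continuous_on S (D a b)" for a b
    unfolding D_def by (intro smooth_on_continuous smooth_on_frechet_derivative f)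
  have "\<exists>d>0. \<forall>y\<in>ball x d. y \<in> S \<and> dist (D a b y) (D a b x) < \<epsilon>" for a b
  proof -
    have "isCont (D a b) x" using cont S continuous_on_eq_continuous_at by blast
    then obtain d where d: "d > 0" "\<And>y. dist y x < d \<Longrightarrow> dist (D a b y) (D a b x) < \<epsilon>"
      using \<epsilon> unfolding continuous_at by (metis LIM_def dist_self)
    obtain d' where "d' > 0" "ball x d' \<subseteq> S" using S open_contains_ball by blast
    then show ?thesis using d by (intro exI[of _ "min d d'"]) (auto simp: dist_commute subset_iff)
  qed
  then obtain d1 d2 where d1: "d1 > 0" "\<forall>y\<in>ball x d1. y \<in> S \<and> dist (D a b y) (D a b x) < \<epsilon>"
    and d2: "d2 > 0" "\<forall>y\<in>ball x d2. y \<in> S \<and> dist (D b a y) (D b a x) < \<epsilon>" by metis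
  define d where "d = min d1 d2"
  \<comment> \<open>Keeps the parallelogram spanned by \<open>t *\<^sub>R a\<close> and
    \<open>t *\<^sub>R b\<close> within \<open>d / 2\<close> of \<open>x\<close>; the summand 1
    makes the denominator positive even if both vectors vanish.\<close>
  define t where "t = d / (norm a + norm b + 1) / 2"
  have pos: "norm a + norm b + 1 > 0" by (simp add: add_nonneg_pos)
  have d0: "d > 0" using d1 d2 unfolding d_def by simp
  have t: "t > 0" unfolding t_def using pos d0 by simp
  \<comment> \<open>Only the sum of the norms is prescribed, so that the bound applies to both
    orders of \<open>a\<close> and \<open>b\<close>.\<close>
  have small: "x + s *\<^sub>R v + r *\<^sub>R w \<in> ball x d" if "s \<in> {0..t}" "r \<in> {0..t}"
    and vw: "norm v + norm w = norm a + norm b" for s r v w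
  proof -
    have "norm (s *\<^sub>R v + r *\<^sub>R w) \<le> s * norm v + r * norm w"
      using that norm_triangle_ineq[of "s *\<^sub>R v" "r *\<^sub>R w"] by auto
    also have "\<dots> \<le> t * norm v + t * norm w"
      using that by (intro add_mono mult_right_mono) auto
    also have "\<dots> = t * (norm a + norm b)" by (simp add: vw[symmetric] algebra_simps)
    also have "\<dots> \<le> t * (norm a + norm b + 1)" using t by simp
    also have "\<dots> = d / 2" unfolding t_def using pos by (simp add: divide_simps)
    also have "\<dots> < d" using d0 by simp
    finally have "norm (s *\<^sub>R v + r *\<^sub>R w) < d" .
    moreover have "dist (x + s *\<^sub>R v + r *\<^sub>R w) x = norm (s *\<^sub>R v + r *\<^sub>R w)"
      by (simp add: dist_norm add.assoc)
    ultimately show ?thesis by (simp add: dist_commute)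
  qed
  have sm: "y \<in> S \<Longrightarrow> f differentiable (at y)"
    "y \<in> S \<Longrightarrow> (\<lambda>y. frechet_derivative f (at y) c) differentiable (at y)" for y c
    using f smooth_on_frechet_derivative smooth_on_differentiable by blast+
  have inS: "x + s *\<^sub>R v + r *\<^sub>R w \<in> S" if "s \<in> {0..t}" "r \<in> {0..t}"
    "norm v + norm w = norm a + norm b" for s r v w
    using small[OF that] d1 unfolding d_def by auto
  obtain s r where 1: "s \<in> {0..t}" "r \<in> {0..t}"
    "f (x + t *\<^sub>R a + t *\<^sub>R b) - f (x + t *\<^sub>R b) - f (x + t *\<^sub>R a) + f x = t * (t * D a b (x + s *\<^sub>R a + r *\<^sub>R b))"
    using second_difference[of S f a t x b, OF sm t inS] unfolding D_def by auto
  obtain s' r' where 2: "s' \<in> {0..t}" "r' \<in> {0..t}"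
    "f (x + t *\<^sub>R b + t *\<^sub>R a) - f (x + t *\<^sub>R a) - f (x + t *\<^sub>R b) + f x = t * (t * D b a (x + s' *\<^sub>R b + r' *\<^sub>R a))"
    using second_difference[of S f b t x a, OF sm t inS] unfolding D_def by auto
  have "t * (t * D a b (x + s *\<^sub>R a + r *\<^sub>R b)) = t * (t * D b a (x + s' *\<^sub>R b + r' *\<^sub>R a))"
    using 1(3) 2(3) by (simp add: algebra_simps)
  then have eq: "D a b (x + s *\<^sub>R a + r *\<^sub>R b) = D b a (x + s' *\<^sub>R b + r' *\<^sub>R a)" using t by simp
  have "dist (D a b (x + s *\<^sub>R a + r *\<^sub>R b)) (D a b x) < \<epsilon>"
    using small[OF 1(1,2)] d1 unfolding d_def by auto
  moreover have "dist (D b a (x + s' *\<^sub>R b + r' *\<^sub>R a)) (D b a x) < \<epsilon>"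
    using small[OF 2(1,2), of b a] d2 unfolding d_def by auto
  ultimately have "\<bar>D a b x - D b a x\<bar> < \<epsilon> + \<epsilon>"
    unfolding eq using dist_triangle2[of "D a b x" "D b a x" "D b a (x + s' *\<^sub>R b + r' *\<^sub>R a)"]
    by (simp add: dist_real_def[of "D a b x" "D b a x"] dist_commute)
  then show False unfolding \<epsilon>_def by simp
qed

text \<open>Taking the inner product with a basis vector commutes with differentiation, so
  smoothness and both iterated derivatives pass to the real components.\<close>

lemma second_derivative_symmetric:
  fixes f :: "'a::euclidean_space \<Rightarrow> 'b::euclidean_space"
  assumes f: "smooth_on f S" and S: "open S" "x \<in> S"
  shows "frechet_derivative (\<lambda>y. frechet_derivative f (at y) a) (at x) b =
    frechet_derivative (\<lambda>y. frechet_derivative f (at y) b) (at x) a"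
proof (rule euclidean_eqI)
  fix i :: 'b assume "i \<in> Basis"
  have comp: "frechet_derivative (\<lambda>y. F y \<bullet> i) (at y) v = frechet_derivative F (at y) v \<bullet> i"
    if "F differentiable (at y)" for F :: "'a \<Rightarrow> 'b" and y v
  proof -
    have "((\<lambda>y. F y \<bullet> i) has_derivative (\<lambda>v. frechet_derivative F (at y) v \<bullet> i)) (at y)"
      using that unfolding frechet_derivative_works by (rule has_derivative_inner_left)
    then show ?thesis by (simp add: frechet_derivative_eqI)
  qed
  have sm: "smooth_on (\<lambda>y. F y \<bullet> i) S" if F: "smooth_on F S" for F :: "'a \<Rightarrow> 'b"
    unfolding smooth_on_def
  proof
    fix k
    show "Ck_on k (\<lambda>y. F y \<bullet> i) S" using F
    proof (induction k arbitrary: F)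
      case 0
      then show ?case by (simp add: continuous_on_inner smooth_on_continuous)
    next
      case (Suc k)
      have "Ck_on k (\<lambda>y. frechet_derivative F (at y) v \<bullet> i) S" for v
        by (rule Suc.IH) (simp add: Suc.prems smooth_on_frechet_derivative)
      then have "Ck_on k (\<lambda>y. frechet_derivative (\<lambda>y. F y \<bullet> i) (at y) v) S" for v
        by (rule Ck_on_cong_open[OF S(1), rotated])
          (simp add: comp smooth_on_differentiable[OF Suc.prems])
      then show ?case using smooth_on_differentiable[OF Suc.prems]
        by (auto intro!: differentiable_compose[of "\<lambda>y. y \<bullet> i"] bounded_linear_imp_differentiable bounded_linear_inner_left)
    qed
  qed
  have "frechet_derivative (\<lambda>y. frechet_derivative f (at y) a) (at x) b \<bullet> i =
    frechet_derivative (\<lambda>y. frechet_derivative (\<lambda>y. f y \<bullet> i) (at y) a) (at x) b" for a b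
  proof -
    have "frechet_derivative (\<lambda>y. frechet_derivative (\<lambda>y. f y \<bullet> i) (at y) a) (at x)
      = frechet_derivative (\<lambda>y. frechet_derivative f (at y) a \<bullet> i) (at x)"
      by (rule frechet_derivative_cong_open[OF S]) (simp add: comp smooth_on_differentiable[OF f])
    then show ?thesis
      using comp smooth_on_differentiable[OF smooth_on_frechet_derivative[OF f] S(2)] by simp
  qed
  then show "frechet_derivative (\<lambda>y. frechet_derivative f (at y) a) (at x) b \<bullet> i =
    frechet_derivative (\<lambda>y. frechet_derivative f (at y) b) (at x) a \<bullet> i"
    using second_derivative_symmetric_real[OF sm[OF f] S] by simp
qed

text \<open>A product rule that needs derivatives of \<open>M\<close> only for fixed arguments.
  Expanding the argument in the finite basis turns \<open>M y (w y)\<close> into a finite sum of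
  scalars times vectors.\<close>

lemma has_derivative_linear_family:
  fixes M :: "'x::real_normed_vector \<Rightarrow> 'a::euclidean_space \<Rightarrow> 'b::real_normed_vector"
  assumes S: "open S" "x \<in> S" and lin: "\<And>y. y \<in> S \<Longrightarrow> linear (M y)"
    and M: "\<And>a. ((\<lambda>y. M y a) has_derivative M' a) (at x)"
    and w: "(w has_derivative w') (at x)"
  shows "((\<lambda>y. M y (w y)) has_derivative (\<lambda>k. M' (w x) k + M x (w' k))) (at x)"
proof -
  have expand: "M y a = (\<Sum>i\<in>Basis. (a \<bullet> i) *\<^sub>R M y i)" if "y \<in> S" for y a
    using lin[OF that] by (subst euclidean_representation[of a, symmetric])
      (simp add: linear_sum linear_cmul)
  have "((\<lambda>y. \<Sum>i\<in>Basis. (w x \<bullet> i) *\<^sub>R M y i) has_derivative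
      (\<lambda>k. \<Sum>i\<in>Basis. (w x \<bullet> i) *\<^sub>R M' i k)) (at x)"
    by (auto intro!: derivative_eq_intros M)
  then have "((\<lambda>y. M y (w x)) has_derivative (\<lambda>k. \<Sum>i\<in>Basis. (w x \<bullet> i) *\<^sub>R M' i k)) (at x)"
    by (rule has_derivative_transform_within_open[OF _ S]) (simp add: expand)
  \<comment> \<open>Linearity of \<open>M'\<close> in its first argument is not assumed; uniqueness
    of the derivative forces the expansion that is needed.\<close>
  then have M': "M' (w x) = (\<lambda>k. \<Sum>i\<in>Basis. (w x \<bullet> i) *\<^sub>R M' i k)"
    using M has_derivative_unique by blast
  have "((\<lambda>y. \<Sum>i\<in>Basis. (w y \<bullet> i) *\<^sub>R M y i) has_derivative
      (\<lambda>k. M' (w x) k + M x (w' k))) (at x)"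
    unfolding M' expand[OF S(2), of "w' _"]
    by (auto intro!: derivative_eq_intros M w simp: sum.distrib)
  then show ?thesis
    by (rule has_derivative_transform_within_open[OF _ S]) (simp add: expand)
qed

text \<open>The linear rule is applied twice: with the second argument frozen it differentiates
  \<open>G y (w y) b\<close>, and the resulting family is again linear in \<open>b\<close>.\<close>

lemma has_derivative_bilinear_family:
  fixes G :: "'x::real_normed_vector \<Rightarrow> 'a::euclidean_space \<Rightarrow> 'a \<Rightarrow> 'b::real_normed_vector"
  assumes S: "open S" "x \<in> S" and lin: "\<And>y. y \<in> S \<Longrightarrow> bilinear (G y)"
    and G: "\<And>a b. ((\<lambda>y. G y a b) has_derivative G' a b) (at x)"
    and w: "(w has_derivative w') (at x)" and z: "(z has_derivative z') (at x)"
  shows "((\<lambda>y. G y (w y) (z y)) has_derivative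
    (\<lambda>k. G' (w x) (z x) k + G x (w' k) (z x) + G x (w x) (z' k))) (at x)"
proof (rule has_derivative_linear_family[OF S _ _ z, of "\<lambda>y. G y (w y)" "\<lambda>b k. G' (w x) b k + G x (w' k) b"])
  show "linear (G y (w y))" if "y \<in> S" for y using lin[OF that] unfolding bilinear_def by simp
  show "((\<lambda>y. G y (w y) b) has_derivative (\<lambda>k. G' (w x) b k + G x (w' k) b)) (at x)" for b
    by (rule has_derivative_linear_family[OF S _ _ w, of "\<lambda>y a. G y a b" "\<lambda>a. G' a b"])
      (use lin G in \<open>auto simp: bilinear_def\<close>)
qed

section \<open>Linear algebra of one inner product: Riesz representation, Christoffel symbols,
  orthonormal expansion\<close>

locale inner_form =
  fixes G :: "'e::euclidean_space \<Rightarrow> 'e \<Rightarrow> real"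
  assumes bilinear: "bilinear G" and sym: "G a b = G b a" and pos: "a \<noteq> 0 \<Longrightarrow> G a a > 0"
begin

lemma nondegenerate: "(\<And>b. G a b = G a' b) \<Longrightarrow> a = a'"
  by (metis bilinear bilinear_lsub diff_self eq_iff_diff_eq_0 less_irrefl pos)

text \<open>\<open>T\<close> is the Gram operator of \<open>G\<close> relative to the standard inner
  product. Nondegeneracy makes it injective, and finite dimension makes it surjective.\<close>

lemma riesz:
  assumes "linear L"
  shows "\<exists>a. \<forall>b. G a b = L b"
proof -
  define T where "T a = (\<Sum>b\<in>Basis. G a b *\<^sub>R b)" for a
  have T_inner: "T a \<bullet> b = G a b" for a b
  proof -
    have "linear (G a)" using bilinear unfolding bilinear_def by simp
    then have "G a b = (\<Sum>i\<in>Basis. (b \<bullet> i) * G a i)"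
      by (subst euclidean_representation[of b, symmetric]) (simp add: linear_sum linear_cmul)
    then show ?thesis unfolding T_def by (simp add: inner_sum_left inner_commute[of b] mult.commute)
  qed
  have "linear T"
    by (rule linearI; rule euclidean_eqI)
      (simp_all add: T_inner inner_left_distrib bilinear_ladd[OF bilinear] bilinear_lmul[OF bilinear])
  moreover have "inj T" by (rule injI, rule nondegenerate) (metis T_inner)
  ultimately have "surj T" using linear_injective_imp_surjective by blast
  then obtain a where a: "T a = (\<Sum>b\<in>Basis. L b *\<^sub>R b)" by (metis surjD)
  have L: "L b = (\<Sum>i\<in>Basis. (b \<bullet> i) * L i)" for b
    using assms by (subst euclidean_representation[of b, symmetric]) (simp add: linear_sum linear_cmul)
  have "G a b = L b" for b
    unfolding L[of b] T_inner[symmetric] a by (simp add: inner_sum_left inner_commute[of b] mult.commute)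
  then show ?thesis by blast
qed

text \<open>Koszul's formula: by symmetry of the connection the combination
  \<open>D k a b + D a k b - D b k a\<close> isolates twice \<open>G (\<Gamma> k a) b\<close>, and
  \<open>G\<close> is nondegenerate. Bilinearity of the candidates does not enter, which spares
  checking it for a new candidate.\<close>

lemma christoffel_unique:
  assumes "\<And>a b. \<Gamma> a b = \<Gamma> b a" "\<And>a b. \<Gamma>' a b = \<Gamma>' b a"
    and "\<And>k a b. D k a b = G (\<Gamma> k a) b + G a (\<Gamma> k b)"
    and "\<And>k a b. D k a b = G (\<Gamma>' k a) b + G a (\<Gamma>' k b)"
  shows "\<Gamma> = \<Gamma>'"
proof (intro ext nondegenerate)
  have koszul: "2 * G (\<Lambda> k a) b = D k a b + D a k b - D b k a"
    if "\<And>a b. \<Lambda> a b = \<Lambda> b a" "\<And>k a b. D k a b = G (\<Lambda> k a) b + G a (\<Lambda> k b)" for \<Lambda> k a b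
    using that(2)[of k a b] that(2)[of a k b] that(2)[of b k a] that(1)[of a k] that(1)[of b k]
      that(1)[of b a] sym[of a "\<Lambda> k b"]
      sym[of k "\<Lambda> a b"] sym[of k "\<Lambda> b a"] sym[of a "\<Lambda> b k"] by simp
  show "G (\<Gamma> k a) b = G (\<Gamma>' k a) b" for k a b
    using koszul[OF assms(1,3), of k a b] koszul[OF assms(2,4), of k a b] by linarith
qed

text \<open>The Koszul combination is linear in its last slot, so the Riesz representation defines
  \<open>\<Gamma>\<close> by it; the required properties are read off after pairing with an
  arbitrary vector.\<close>

lemma christoffel_exists:
  assumes D: "\<And>a b. linear (\<lambda>k. D k a b)" "\<And>k b. linear (\<lambda>a. D k a b)" "\<And>k a. linear (\<lambda>b. D k a b)"
    and Dsym: "\<And>k a b. D k a b = D k b a"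
  shows "\<exists>\<Gamma>. bilinear \<Gamma> \<and> (\<forall>a b. \<Gamma> a b = \<Gamma> b a) \<and> (\<forall>k a b. D k a b = G (\<Gamma> k a) b + G a (\<Gamma> k b))"
proof -
  have "linear (\<lambda>b. (D k a b + D a k b - D b k a) / 2)" for k a
    by (rule linearI) (simp_all add: linear_add[OF D(1)] linear_add[OF D(3)] linear_cmul[OF D(1)]
        linear_cmul[OF D(3)] field_simps)
  then have "\<exists>\<Gamma>. \<forall>b. G \<Gamma> b = (D k a b + D a k b - D b k a) / 2" for k a by (rule riesz)
  then obtain \<Gamma> where \<Gamma>: "\<And>k a b. G (\<Gamma> k a) b = (D k a b + D a k b - D b k a) / 2" by metis
  have "bilinear \<Gamma>"
    unfolding bilinear_def
    by (intro conjI allI linearI; rule nondegenerate)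
      (simp_all add: \<Gamma> bilinear_ladd[OF bilinear] bilinear_lmul[OF bilinear] linear_add[OF D(1)]
        linear_add[OF D(2)] linear_add[OF D(3)] linear_cmul[OF D(1)] linear_cmul[OF D(2)]
        linear_cmul[OF D(3)] field_simps)
  moreover have "\<Gamma> a b = \<Gamma> b a" for a b
    by (rule nondegenerate) (use Dsym[of _ a b] in \<open>simp add: \<Gamma>\<close>)
  moreover have "D k a b = G (\<Gamma> k a) b + G a (\<Gamma> k b)" for k a b
    using Dsym[of k a b] Dsym[of a k b] Dsym[of b k a] by (simp add: \<Gamma> sym[of a "\<Gamma> k b"] field_simps)
  ultimately show ?thesis by blast
qed

text \<open>Pairing with \<open>w j\<close> extracts the coefficient of \<open>w j\<close>. This
  makes the vectors independent, hence spanning since their number is the dimension, and it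
  identifies the coefficients of \<open>v\<close>.\<close>

lemma orthonormal_expansion:
  assumes w: "\<And>i j. i \<in> {1..DIM('e)} \<Longrightarrow> j \<in> {1..DIM('e)} \<Longrightarrow> G (w i) (w j) = (if i = j then 1 else 0)"
  shows "v = (\<Sum>i = 1..DIM('e). G v (w i) *\<^sub>R w i)"
proof -
  define I where "I = {1..DIM('e)}"
  have fin: "finite I" by (simp add: I_def)
  have w: "G (w i) (w j) = (if i = j then 1 else 0)" if "i \<in> I" "j \<in> I" for i j
    by (rule assms) (use that in \<open>simp_all add: I_def\<close>)
  have coeff: "G (\<Sum>i\<in>I. r i *\<^sub>R w i) (w j) = r j" if "j \<in> I" for r j
  proof -
    have "linear (\<lambda>a. G a (w j))" using bilinear unfolding bilinear_def by simp
    then have "G (\<Sum>i\<in>I. r i *\<^sub>R w i) (w j) = (\<Sum>i\<in>I. r i * G (w i) (w j))"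
      by (simp add: linear_sum[OF \<open>linear (\<lambda>a. G a (w j))\<close>] linear_cmul[OF \<open>linear (\<lambda>a. G a (w j))\<close>])
    also have "\<dots> = (\<Sum>i\<in>I. if i = j then r i else 0)"
      by (rule sum.cong) (use w that in auto)
    also have "\<dots> = r j" using that by (simp add: fin)
    finally show ?thesis .
  qed
  have inj: "inj_on w I" by (rule inj_onI) (metis w zero_neq_one)
  have "independent (w ` I)"
    unfolding independent_explicit_finite_subsets
  proof (intro allI impI ballI)
    fix T r y assume T: "T \<subseteq> w ` I" "finite T" and s: "(\<Sum>v\<in>T. r v *\<^sub>R v) = 0" and y: "y \<in> T"
    \<comment> \<open>The coefficients are extended by zero from \<open>T\<close> to the whole
      family, so that coefficient extraction over \<open>I\<close> applies.\<close>
    have "(\<Sum>v\<in>T. r v *\<^sub>R v) = (\<Sum>v\<in>w ` I. (if v \<in> T then r v else 0) *\<^sub>R v)"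
      using T(1) by (intro sum.mono_neutral_cong_left) (auto simp: fin)
    then have 0: "(\<Sum>i\<in>I. (if w i \<in> T then r (w i) else 0) *\<^sub>R w i) = 0"
      using s by (simp add: sum.reindex[OF inj] o_def)
    obtain i where "i \<in> I" "y = w i" using y T(1) by blast
    then show "r y = 0"
      using coeff[of i "\<lambda>i. if w i \<in> T then r (w i) else 0"] 0 y bilinear_lzero[OF bilinear] by simp
  qed
  moreover have "card (w ` I) = DIM('e)" by (simp add: card_image[OF inj]) (simp add: I_def)
  ultimately have "span (w ` I) = UNIV" using card_eq_dim[of "w ` I" UNIV] by (simp add: dim_UNIV I_def top.extremum_unique)
  then obtain r where "v = (\<Sum>y\<in>w ` I. r y *\<^sub>R y)"
    using span_finite[of "w ` I"] by (auto simp: I_def)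
  then have v: "v = (\<Sum>i\<in>I. r (w i) *\<^sub>R w i)" by (simp add: sum.reindex[OF inj])
  then show ?thesis unfolding I_def[symmetric] using coeff[of _ "\<lambda>i. r (w i)"] by (auto intro!: sum.cong)
qed

end

section \<open>Tangent vectors and directional derivatives\<close>

locale manifold =
  fixes A :: "('p::{t2_space, second_countable_topology}, 'e::euclidean_space) chart set"
  assumes smooth_manifold: "smooth_manifold A"
begin

lemma charts_atD:
  assumes "c \<in> charts_at A p"
  shows "c \<in> A" "p \<in> fst c"
  using assms unfolding charts_at_def by auto

lemma chart_homeomorphism:
  "c \<in> A \<Longrightarrow> homeomorphism (fst c) (snd c ` fst c) (snd c) (chart_inv c)"
  using smooth_manifold unfolding smooth_manifold_def by blast

lemma open_chart_domain: "c \<in> A \<Longrightarrow> open (fst c)"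
  using smooth_manifold unfolding smooth_manifold_def by blast

lemma chart_inv_chart [simp]: "c \<in> charts_at A p \<Longrightarrow> chart_inv c (snd c p) = p"
  using homeomorphism_apply1[OF chart_homeomorphism] charts_atD by metis

lemma ex_chart: "\<exists>c. c \<in> charts_at A p"
  using smooth_manifold unfolding smooth_manifold_def charts_at_def by blast

lemma open_chart_image:
  assumes c: "c \<in> A" and "open S"
  shows "open (snd c ` (fst c \<inter> S))"
proof -
  have "openin (top_of_set (snd c ` fst c)) (snd c ` (fst c \<inter> S))"
    using homeomorphism_imp_open_map[OF chart_homeomorphism[OF c]] \<open>open S\<close>
    by (simp add: openin_open_Int)
  moreover have "open (snd c ` fst c)"
    using smooth_manifold c unfolding smooth_manifold_def by blast
  ultimately show ?thesis using openin_open_trans by blast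
qed

lemma chart_imageD:
  assumes "c \<in> A" "y \<in> snd c ` (fst c \<inter> S)"
  shows "c \<in> charts_at A (chart_inv c y)" "chart_inv c y \<in> S" "snd c (chart_inv c y) = y"
proof -
  obtain p where "p \<in> fst c" "p \<in> S" "y = snd c p" using assms by blast
  then show "c \<in> charts_at A (chart_inv c y)" "chart_inv c y \<in> S" "snd c (chart_inv c y) = y"
    using homeomorphism_apply1[OF chart_homeomorphism[OF assms(1)], of p] assms(1)
    by (auto simp: charts_at_def)
qed

lemma chart_imageI: "c \<in> charts_at A p \<Longrightarrow> p \<in> S \<Longrightarrow> snd c p \<in> snd c ` (fst c \<inter> S)"
  using charts_atD by blast

text \<open>Transfers an identity valid near \<open>p\<close> on the manifold to coordinate
  expressions: the chart image of an open set is open, and values at coordinates outside it do not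
  matter.\<close>

lemma has_derivative_cong_chart:
  assumes c: "c \<in> charts_at A p" and S: "open S" "p \<in> S"
    and f: "(f has_derivative f') (at (snd c p))"
    and eq: "\<And>y. c \<in> charts_at A (chart_inv c y) \<Longrightarrow> chart_inv c y \<in> S \<Longrightarrow>
      snd c (chart_inv c y) = y \<Longrightarrow> f y = f2 y"
  shows "(f2 has_derivative f') (at (snd c p))"
proof (rule has_derivative_transform_within_open[OF f open_chart_image[OF charts_atD(1)[OF c] S(1)]
        chart_imageI[OF c S(2)]])
  show "f y = f2 y" if "y \<in> snd c ` (fst c \<inter> S)" for y
    using chart_imageD[OF charts_atD(1)[OF c] that] by (rule eq)
qed

text \<open>The Jacobian taking components in \<open>c\<close> to components in \<open>c'\<close>.
  It is indexed by the point rather than by its coordinates, so it can be differentiated in other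
  charts or along a map.\<close>

definition dtrans :: "('p, 'e) chart \<Rightarrow> ('p, 'e) chart \<Rightarrow> 'p \<Rightarrow> 'e \<Rightarrow> 'e" where
  "dtrans c c' q = frechet_derivative (snd c' \<circ> chart_inv c) (at (snd c q))"

lemma smooth_transition:
  "c \<in> A \<Longrightarrow> c' \<in> A \<Longrightarrow> smooth_on (snd c' \<circ> chart_inv c) (snd c ` (fst c \<inter> fst c'))"
  using smooth_manifold unfolding smooth_manifold_def by blast

lemma has_derivative_transition:
  assumes "c \<in> charts_at A p" "c' \<in> charts_at A p"
  shows "((snd c' \<circ> chart_inv c) has_derivative dtrans c c' p) (at (snd c p))"
  unfolding dtrans_def
  by (rule smooth_on_has_derivative[OF smooth_transition])
    (use assms in \<open>auto simp: charts_at_def\<close>)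

lemma linear_dtrans: "c \<in> charts_at A p \<Longrightarrow> c' \<in> charts_at A p \<Longrightarrow> linear (dtrans c c' p)"
  using has_derivative_transition has_derivative_linear by blast

lemma has_derivative_change_chart:
  assumes c: "c \<in> charts_at A p" "c' \<in> charts_at A p"
    and f: "((f \<circ> chart_inv c') has_derivative f') (at (snd c' p))"
  shows "((f \<circ> chart_inv c) has_derivative (\<lambda>a. f' (dtrans c c' p a))) (at (snd c p))"
proof (rule has_derivative_cong_chart[OF c(1) open_chart_domain[OF charts_atD(1)[OF c(2)]] charts_atD(2)[OF c(2)]])
  have "((f \<circ> chart_inv c') has_derivative f') (at ((snd c' \<circ> chart_inv c) (snd c p)))"
    using f c by simp
  then show "((f \<circ> chart_inv c' \<circ> (snd c' \<circ> chart_inv c)) has_derivative (\<lambda>a. f' (dtrans c c' p a))) (at (snd c p))"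
    using diff_chain_at[OF has_derivative_transition[OF c]] unfolding comp_def by blast
  show "(f \<circ> chart_inv c' \<circ> (snd c' \<circ> chart_inv c)) y = (f \<circ> chart_inv c) y"
    if "chart_inv c y \<in> fst c'" for y
    using chart_inv_chart[of c' "chart_inv c y"] that charts_atD(1)[OF c(2)] by (simp add: charts_at_def)
qed

text \<open>The cocycle rule: the chain rule and the direct computation give two derivatives of the
  same coordinate change, and derivatives are unique.\<close>

lemma dtrans_dtrans:
  assumes c: "c \<in> charts_at A p" "c' \<in> charts_at A p" "c'' \<in> charts_at A p"
  shows "dtrans c' c'' p (dtrans c c' p a) = dtrans c c'' p a"
  using has_derivative_unique[OF has_derivative_change_chart[OF c(1,2) has_derivative_transition[OF c(2,3)]]
      has_derivative_transition[OF c(1,3)]] by metis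

lemma dtrans_self:
  assumes c: "c \<in> charts_at A p"
  shows "dtrans c c p a = a"
proof -
  have "((snd c \<circ> chart_inv c) has_derivative (\<lambda>x. x)) (at (snd c p))"
    by (rule has_derivative_cong_chart[OF c open_UNIV UNIV_I has_derivative_ident]) simp
  then show ?thesis
    using has_derivative_unique[OF _ has_derivative_transition[OF c c]] by metis
qed

lemma tangent_transform:
  "v \<in> tangent_space A p \<Longrightarrow> c \<in> charts_at A p \<Longrightarrow> c' \<in> charts_at A p \<Longrightarrow> v c' = dtrans c c' p (v c)"
  unfolding tangent_space_def dtrans_def by blast

lemma tangent_outside: "v \<in> tangent_space A p \<Longrightarrow> c \<notin> charts_at A p \<Longrightarrow> v c = 0"
  unfolding tangent_space_def by blast

text \<open>By the cocycle rule, compatibility with one fixed chart implies compatibility between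
  any two charts.\<close>

lemma tangentI:
  assumes "c \<in> charts_at A p" "\<And>c'. c' \<in> charts_at A p \<Longrightarrow> v c' = dtrans c c' p (v c)"
    "\<And>c'. c' \<notin> charts_at A p \<Longrightarrow> v c' = 0"
  shows "v \<in> tangent_space A p"
proof -
  have "v c2 = dtrans c1 c2 p (v c1)" if "c1 \<in> charts_at A p" "c2 \<in> charts_at A p" for c1 c2
    using assms(2)[OF that(1)] assms(2)[OF that(2)] dtrans_dtrans[OF assms(1) that] by simp
  then show ?thesis unfolding tangent_space_def dtrans_def[symmetric] using assms(3) by blast
qed

lemma tangent_eqI:
  assumes "v \<in> tangent_space A p" "w \<in> tangent_space A p" "c \<in> charts_at A p" "v c = w c"
  shows "v = w"
proof
  show "v c' = w c'" for c'
    using assms tangent_transform[OF assms(1,3), of c'] tangent_transform[OF assms(2,3), of c']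
      tangent_outside by (cases "c' \<in> charts_at A p") metis+
qed

lemma coord_field_eq: "c \<in> charts_at A p \<Longrightarrow> c' \<in> charts_at A p \<Longrightarrow> coord_field A c a p c' = dtrans c c' p a"
  unfolding coord_field_def dtrans_def by simp

lemma coord_field_self [simp]: "c \<in> charts_at A p \<Longrightarrow> coord_field A c a p c = a"
  by (simp add: coord_field_eq dtrans_self)

lemma coord_field_tangent [simp]: "c \<in> charts_at A p \<Longrightarrow> coord_field A c a p \<in> tangent_space A p"
  by (rule tangentI) (auto simp: coord_field_eq dtrans_self, simp add: coord_field_def)

lemma tangent_eq_coord_field:
  "v \<in> tangent_space A p \<Longrightarrow> c \<in> charts_at A p \<Longrightarrow> v = coord_field A c (v c) p"
  by (rule tangent_eqI[of _ p _ c]) simp_all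

lemma tangent_add:
  assumes v: "v \<in> tangent_space A p" and w: "w \<in> tangent_space A p"
  shows "(\<lambda>c. v c + w c) \<in> tangent_space A p"
proof -
  obtain c where c: "c \<in> charts_at A p" using ex_chart by blast
  show ?thesis
  proof (rule tangentI[OF c])
    show "v c' + w c' = dtrans c c' p (v c + w c)" if "c' \<in> charts_at A p" for c'
      unfolding tangent_transform[OF v c that] tangent_transform[OF w c that]
      by (simp add: linear_add[OF linear_dtrans[OF c that]])
  qed (simp add: tangent_outside[OF v] tangent_outside[OF w])
qed

lemma tangent_scaleR:
  assumes v: "v \<in> tangent_space A p"
  shows "(\<lambda>c. r *\<^sub>R v c) \<in> tangent_space A p"
proof -
  obtain c where c: "c \<in> charts_at A p" using ex_chart by blast
  show ?thesis
  proof (rule tangentI[OF c])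
    show "r *\<^sub>R v c' = dtrans c c' p (r *\<^sub>R v c)" if "c' \<in> charts_at A p" for c'
      unfolding tangent_transform[OF v c that] by (simp add: linear_cmul[OF linear_dtrans[OF c that]])
  qed (simp add: tangent_outside[OF v])
qed

lemma tangent_zero: "(\<lambda>c. 0) \<in> tangent_space A p"
  using ex_chart[of p] by (elim exE, intro tangentI) (auto simp: linear_0[OF linear_dtrans])

lemma tangent_diff:
  "v \<in> tangent_space A p \<Longrightarrow> w \<in> tangent_space A p \<Longrightarrow> (\<lambda>c. v c - w c) \<in> tangent_space A p"
  using tangent_add[OF _ tangent_scaleR[of w p "-1"]] by simp

lemma tangent_sum:
  "(\<And>i. i \<in> I \<Longrightarrow> v i \<in> tangent_space A p) \<Longrightarrow> (\<lambda>c. \<Sum>i\<in>I. v i c) \<in> tangent_space A p"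
  by (induction I rule: infinite_finite_induct) (auto simp: tangent_zero tangent_add)

text \<open>Resolves the definite description: the Jacobian in the chain rule cancels against the
  one in the transformation of \<open>v\<close>, so every chart gives the same value.\<close>

lemma dir_deriv_eq:
  assumes v: "v \<in> tangent_space A p" and c: "c \<in> charts_at A p"
    and f: "((f \<circ> chart_inv c) has_derivative f') (at (snd c p))"
  shows "dir_deriv A p v f = f' (v c)"
proof -
  have "frechet_derivative (f \<circ> chart_inv c') (at (snd c' p)) (v c') = f' (v c)" if "c' \<in> charts_at A p" for c'
    using frechet_derivative_eqI[OF has_derivative_change_chart[OF that c f]] tangent_transform[OF v that c]
    by simp
  then show ?thesis unfolding dir_deriv_def using c by (intro the_equality) metis+
qed

text \<open>All charts are required so that later arguments may pick any of them;
  \<open>differentiable_funI\<close> shows that one chart suffices.\<close>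

definition differentiable_fun :: "'p \<Rightarrow> ('p \<Rightarrow> 'b::real_normed_vector) \<Rightarrow> bool" where
  "differentiable_fun p f \<longleftrightarrow> (\<forall>c\<in>charts_at A p. (f \<circ> chart_inv c) differentiable (at (snd c p)))"

lemma differentiable_funI:
  assumes "c \<in> charts_at A p" "(f \<circ> chart_inv c) differentiable (at (snd c p))"
  shows "differentiable_fun p f"
  using assms has_derivative_change_chart[OF _ assms(1)]
  unfolding differentiable_fun_def differentiable_def by metis

text \<open>Names the coordinate derivative intrinsically. Together with its converse
  \<open>has_dir_deriv_rule\<close> it turns each rule for \<open>has_derivative\<close> into a rule
  for \<open>dir_deriv\<close>.\<close>

lemma has_dir_deriv:
  assumes "differentiable_fun p f" "c \<in> charts_at A p"
  shows "((f \<circ> chart_inv c) has_derivative (\<lambda>a. dir_deriv A p (coord_field A c a p) f)) (at (snd c p))"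
proof -
  obtain f' where f': "((f \<circ> chart_inv c) has_derivative f') (at (snd c p))"
    using assms unfolding differentiable_fun_def differentiable_def by blast
  then have "f' = (\<lambda>a. dir_deriv A p (coord_field A c a p) f)"
    using dir_deriv_eq[OF coord_field_tangent[OF assms(2)] assms(2) f'] assms(2) by simp
  with f' show ?thesis by simp
qed

lemma has_dir_deriv_rule:
  assumes c: "c \<in> charts_at A p"
    and f: "((f \<circ> chart_inv c) has_derivative f') (at (snd c p))"
  shows "differentiable_fun p f" "v \<in> tangent_space A p \<Longrightarrow> dir_deriv A p v f = f' (v c)"
  using differentiable_funI[OF c] dir_deriv_eq[OF _ c f] f by (auto simp: differentiable_def)

lemma dir_deriv_coord:
  "v \<in> tangent_space A p \<Longrightarrow> c \<in> charts_at A p \<Longrightarrow>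
    dir_deriv A p (coord_field A c (v c) p) f = dir_deriv A p v f"
  by (simp add: tangent_eq_coord_field[symmetric])

lemma dir_deriv_cong:
  assumes S: "open S" "p \<in> S" and eq: "\<And>q. q \<in> S \<Longrightarrow> f q = k q" and f: "differentiable_fun p f"
  shows "differentiable_fun p k" "v \<in> tangent_space A p \<Longrightarrow> dir_deriv A p v k = dir_deriv A p v f"
proof -
  obtain c where c: "c \<in> charts_at A p" using ex_chart by blast
  have k: "((k \<circ> chart_inv c) has_derivative (\<lambda>a. dir_deriv A p (coord_field A c a p) f)) (at (snd c p))"
    by (rule has_derivative_cong_chart[OF c S has_dir_deriv[OF f c]]) (simp add: eq)
  show "differentiable_fun p k" by (rule has_dir_deriv_rule(1)[OF c k])
  show "dir_deriv A p v k = dir_deriv A p v f" if "v \<in> tangent_space A p"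
    unfolding has_dir_deriv_rule(2)[OF c k that] by (rule dir_deriv_coord[OF that c])
qed

lemma dir_deriv_scaleR:
  fixes f :: "'p \<Rightarrow> real"
  assumes "differentiable_fun p f" "differentiable_fun p k"
  shows "differentiable_fun p (\<lambda>q. f q *\<^sub>R k q)"
    "v \<in> tangent_space A p \<Longrightarrow>
      dir_deriv A p v (\<lambda>q. f q *\<^sub>R k q) = dir_deriv A p v f *\<^sub>R k p + f p *\<^sub>R dir_deriv A p v k"
proof -
  obtain c where c: "c \<in> charts_at A p" using ex_chart by blast
  note r = has_dir_deriv_rule[OF c, of "\<lambda>q. f q *\<^sub>R k q", unfolded comp_def,
      OF has_derivative_scaleR[OF has_dir_deriv[OF assms(1) c, unfolded comp_def]
      has_dir_deriv[OF assms(2) c, unfolded comp_def]]]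
  show "differentiable_fun p (\<lambda>q. f q *\<^sub>R k q)" by (rule r)
  show "dir_deriv A p v (\<lambda>q. f q *\<^sub>R k q) = dir_deriv A p v f *\<^sub>R k p + f p *\<^sub>R dir_deriv A p v k"
    if "v \<in> tangent_space A p" using r(2)[OF that] c by (simp add: dir_deriv_coord[OF that c])
qed

lemmas dir_deriv_mult = dir_deriv_scaleR[where 'a = real, unfolded real_scaleR_def]

lemma dir_deriv_diff:
  assumes "differentiable_fun p f" "differentiable_fun p k"
  shows "differentiable_fun p (\<lambda>q. f q - k q)"
    "v \<in> tangent_space A p \<Longrightarrow>
      dir_deriv A p v (\<lambda>q. f q - k q) = dir_deriv A p v f - dir_deriv A p v k"
proof -
  obtain c where c: "c \<in> charts_at A p" using ex_chart by blast
  note r = has_dir_deriv_rule[OF c, of "\<lambda>q. f q - k q", unfolded comp_def,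
      OF has_derivative_diff[OF has_dir_deriv[OF assms(1) c, unfolded comp_def]
      has_dir_deriv[OF assms(2) c, unfolded comp_def]]]
  show "differentiable_fun p (\<lambda>q. f q - k q)" by (rule r)
  show "dir_deriv A p v (\<lambda>q. f q - k q) = dir_deriv A p v f - dir_deriv A p v k"
    if "v \<in> tangent_space A p" using r(2)[OF that] c by (simp add: dir_deriv_coord[OF that c])
qed

lemma dir_deriv_sum:
  assumes "\<And>i. i \<in> I \<Longrightarrow> differentiable_fun p (f i)"
  shows "differentiable_fun p (\<lambda>q. \<Sum>i\<in>I. f i q)"
    "v \<in> tangent_space A p \<Longrightarrow> dir_deriv A p v (\<lambda>q. \<Sum>i\<in>I. f i q) = (\<Sum>i\<in>I. dir_deriv A p v (f i))"
proof -
  obtain c where c: "c \<in> charts_at A p" using ex_chart by blast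
  note r = has_dir_deriv_rule[OF c, of "\<lambda>q. \<Sum>i\<in>I. f i q", unfolded comp_def,
      OF has_derivative_sum[OF has_dir_deriv[OF assms c, unfolded comp_def]]]
  show "differentiable_fun p (\<lambda>q. \<Sum>i\<in>I. f i q)" by (rule r)
  show "dir_deriv A p v (\<lambda>q. \<Sum>i\<in>I. f i q) = (\<Sum>i\<in>I. dir_deriv A p v (f i))"
    if "v \<in> tangent_space A p" using r(2)[OF _ that] c by (simp add: dir_deriv_coord[OF that c])
qed

text \<open>The outer derivative is relative to a set containing the range of \<open>k\<close>. This
  admits outer functions with only a one-sided derivative, such as \<open>F\<close> at 0.\<close>

lemma dir_deriv_compose:
  fixes k :: "'p \<Rightarrow> real"
  assumes k: "differentiable_fun p k" "range k \<subseteq> S" and F: "(F has_real_derivative F') (at (k p) within S)"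
  shows "differentiable_fun p (\<lambda>q. F (k q))"
    "v \<in> tangent_space A p \<Longrightarrow> dir_deriv A p v (\<lambda>q. F (k q)) = F' * dir_deriv A p v k"
proof -
  obtain c where c: "c \<in> charts_at A p" using ex_chart by blast
  have "(F has_derivative (*) F') (at ((k \<circ> chart_inv c) (snd c p)) within range (k \<circ> chart_inv c))"
    using F k(2) c by (auto simp: has_field_derivative_def intro: has_derivative_subset)
  note r = has_dir_deriv_rule[OF c, of "\<lambda>q. F (k q)", unfolded comp_def,
      OF has_derivative_in_compose[OF has_dir_deriv[OF k(1) c] this, unfolded comp_def]]
  show "differentiable_fun p (\<lambda>q. F (k q))" by (rule r)
  show "dir_deriv A p v (\<lambda>q. F (k q)) = F' * dir_deriv A p v k"
    if "v \<in> tangent_space A p" using r(2)[OF that] c by (simp add: dir_deriv_coord[OF that c])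
qed

text \<open>Linearity in the direction; it later reassembles derivatives along the frame into the
  derivative along \<open>X\<close>.\<close>

lemma dir_deriv_linear:
  assumes f: "differentiable_fun p f" and v: "\<And>i. i \<in> I \<Longrightarrow> v i \<in> tangent_space A p"
  shows "dir_deriv A p (\<lambda>c. \<Sum>i\<in>I. r i *\<^sub>R v i c) f = (\<Sum>i\<in>I. r i *\<^sub>R dir_deriv A p (v i) f)"
proof -
  obtain c where c: "c \<in> charts_at A p" using ex_chart by blast
  note D = has_dir_deriv[OF f c]
  have "dir_deriv A p (\<lambda>c. \<Sum>i\<in>I. r i *\<^sub>R v i c) f
      = dir_deriv A p (coord_field A c (\<Sum>i\<in>I. r i *\<^sub>R v i c) p) f"
    by (rule dir_deriv_coord[OF _ c, symmetric]) (intro tangent_sum tangent_scaleR v)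
  also have "\<dots> = (\<Sum>i\<in>I. r i *\<^sub>R dir_deriv A p (coord_field A c (v i c) p) f)"
    by (simp add: linear_sum[OF has_derivative_linear[OF D]] linear_cmul[OF has_derivative_linear[OF D]])
  also have "\<dots> = (\<Sum>i\<in>I. r i *\<^sub>R dir_deriv A p (v i) f)"
    by (rule sum.cong) (simp_all add: dir_deriv_coord v c)
  finally show ?thesis .
qed

lemma smooth_field_tangent: "smooth_field A U W \<Longrightarrow> p \<in> U \<Longrightarrow> W p \<in> tangent_space A p"
  unfolding smooth_field_def by blast

lemma smooth_field_linear_combination:
  assumes U: "open U" and W: "\<And>i. i \<in> I \<Longrightarrow> smooth_field A U (W i)"
  shows "smooth_field A U (\<lambda>q c. \<Sum>i\<in>I. r i *\<^sub>R W i q c)"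
  unfolding smooth_field_def
proof (intro conjI ballI U)
  show "(\<lambda>c. \<Sum>i\<in>I. r i *\<^sub>R W i q c) \<in> tangent_space A q" if "q \<in> U" for q
    by (intro tangent_sum tangent_scaleR smooth_field_tangent[OF W that])
  show "smooth_on (\<lambda>y. \<Sum>i\<in>I. r i *\<^sub>R W i (chart_inv c y) c) (snd c ` (fst c \<inter> U))" if "c \<in> A" for c
    using W that unfolding smooth_field_def by (intro smooth_on_linear_combination open_chart_image U) auto
qed

end

section \<open>The Levi-Civita connection\<close>

locale riemannian_manifold = manifold A
  for A :: "('p::{t2_space, second_countable_topology}, 'e::euclidean_space) chart set" +
  fixes g :: "'p \<Rightarrow> ('p, 'e) tvec \<Rightarrow> ('p, 'e) tvec \<Rightarrow> real"
  assumes riemannian_metric: "riemannian_metric A g"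
begin

lemma metric_sym: "v \<in> tangent_space A p \<Longrightarrow> w \<in> tangent_space A p \<Longrightarrow> g p v w = g p w v"
  using riemannian_metric unfolding riemannian_metric_def by blast

lemma metric_pos: "v \<in> tangent_space A p \<Longrightarrow> v \<noteq> (\<lambda>c. 0) \<Longrightarrow> g p v v > 0"
  using riemannian_metric unfolding riemannian_metric_def by blast

lemma metric_linear:
  assumes "v \<in> tangent_space A p" "w \<in> tangent_space A p" "z \<in> tangent_space A p"
  shows "g p (\<lambda>c. r *\<^sub>R v c + w c) z = r * g p v z + g p w z"
  using riemannian_metric assms unfolding riemannian_metric_def by blast

lemma metric_add:
  assumes "v \<in> tangent_space A p" "w \<in> tangent_space A p" "z \<in> tangent_space A p"
  shows "g p (\<lambda>c. v c + w c) z = g p v z + g p w z" "g p z (\<lambda>c. v c + w c) = g p z v + g p z w"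
  using metric_linear[OF assms, of 1] metric_sym[OF assms(3)] assms tangent_add[OF assms(1,2)] by simp_all

lemma metric_zero:
  assumes "z \<in> tangent_space A p"
  shows "g p (\<lambda>c. 0) z = 0"
  using metric_add(1)[OF tangent_zero tangent_zero assms] by simp

lemma metric_scaleR:
  assumes "v \<in> tangent_space A p" "z \<in> tangent_space A p"
  shows "g p (\<lambda>c. r *\<^sub>R v c) z = r * g p v z" "g p z (\<lambda>c. r *\<^sub>R v c) = r * g p z v"
  using metric_linear[OF assms(1) tangent_zero assms(2), of r] metric_zero[OF assms(2)]
    metric_sym[OF assms(2)] assms tangent_scaleR[OF assms(1), of r] by simp_all

lemma metric_diff:
  assumes "v \<in> tangent_space A p" "w \<in> tangent_space A p" "z \<in> tangent_space A p"
  shows "g p (\<lambda>c. v c - w c) z = g p v z - g p w z"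
  using metric_add(1)[OF assms(1) tangent_scaleR[OF assms(2), of "-1"] assms(3)]
    metric_scaleR(1)[OF assms(2,3), of "-1"] by simp

lemma metric_sum:
  assumes "\<And>i. i \<in> I \<Longrightarrow> v i \<in> tangent_space A p" "z \<in> tangent_space A p"
  shows "g p (\<lambda>c. \<Sum>i\<in>I. v i c) z = (\<Sum>i\<in>I. g p (v i) z)"
  using assms(1)
proof (induction I rule: infinite_finite_induct)
  case (insert i I)
  then show ?case
    by (simp add: metric_add(1)[OF _ tangent_sum assms(2)])
qed (simp_all add: metric_zero assms(2))

definition gram :: "('p, 'e) chart \<Rightarrow> 'p \<Rightarrow> 'e \<Rightarrow> 'e \<Rightarrow> real" where
  "gram c p a b = g p (coord_field A c a p) (coord_field A c b p)"

lemma metric_eq_gram: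
  "v \<in> tangent_space A p \<Longrightarrow> w \<in> tangent_space A p \<Longrightarrow> c \<in> charts_at A p \<Longrightarrow> g p v w = gram c p (v c) (w c)"
  unfolding gram_def by (simp add: tangent_eq_coord_field[symmetric])

lemma coord_field_linear:
  assumes c: "c \<in> charts_at A p"
  shows "coord_field A c (r *\<^sub>R a + b) p = (\<lambda>c'. r *\<^sub>R coord_field A c a p c' + coord_field A c b p c')"
  by (rule tangent_eqI[OF _ _ c]) (use c in \<open>simp_all add: tangent_add tangent_scaleR\<close>)

text \<open>A vector of the model space corresponds linearly to the value of its coordinate field,
  so the metric at \<open>p\<close> becomes an inner product there and the linear algebra above
  applies.\<close>

lemma inner_form_gram:
  assumes c: "c \<in> charts_at A p"
  shows "inner_form (gram c p)"
proof
  show sym: "gram c p a b = gram c p b a" for a b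
    unfolding gram_def by (rule metric_sym) (simp_all add: c)
  have lin: "gram c p (r *\<^sub>R a + b) z = r * gram c p a z + gram c p b z" for r a b z
    unfolding gram_def coord_field_linear[OF c] by (rule metric_linear) (simp_all add: c)
  have "linear (\<lambda>a. gram c p a z)" for z
    using lin[of 1 _ _ z] lin[of _ _ 0 z] lin[of 1 0 0 z] by (intro linearI) simp_all
  then show "bilinear (gram c p)" using sym unfolding bilinear_def by simp
  show "gram c p a a > 0" if "a \<noteq> 0" for a
    unfolding gram_def
  proof (rule metric_pos)
    have "coord_field A c a p c \<noteq> 0" using that c by simp
    then show "coord_field A c a p \<noteq> (\<lambda>c. 0)" by metis
  qed (simp add: c)
qed

lemma gram_transform:
  assumes c: "c \<in> charts_at A p" "c' \<in> charts_at A p"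
  shows "gram c' p a b = gram c p (dtrans c' c p a) (dtrans c' c p b)"
  unfolding gram_def[of c'] using metric_eq_gram[OF _ _ c(1)] c by (simp add: coord_field_eq)

definition dgram :: "('p, 'e) chart \<Rightarrow> 'p \<Rightarrow> 'e \<Rightarrow> 'e \<Rightarrow> 'e \<Rightarrow> real" where
  "dgram c p k a b = frechet_derivative (\<lambda>y. gram c (chart_inv c y) a b) (at (snd c p)) k"

lemma has_derivative_gram:
  assumes c: "c \<in> charts_at A p"
  shows "((\<lambda>y. gram c (chart_inv c y) a b) has_derivative (\<lambda>k. dgram c p k a b)) (at (snd c p))"
proof -
  have "smooth_on (\<lambda>y. gram c (chart_inv c y) a b) (snd c ` fst c)"
    using riemannian_metric charts_atD(1)[OF c] unfolding riemannian_metric_def gram_def by blast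
  then show ?thesis unfolding dgram_def
    by (rule smooth_on_has_derivative) (simp add: charts_atD(2)[OF c])
qed

text \<open>Symmetry and linearity in \<open>a\<close> and \<open>b\<close> hold for the metric
  coefficients at every point of the chart, hence for their derivatives by uniqueness. These are the
  hypotheses of \<open>christoffel_exists\<close>.\<close>

lemma dgram_linear:
  assumes c: "c \<in> charts_at A p"
  shows "linear (\<lambda>k. dgram c p k a b)" "linear (\<lambda>a. dgram c p k a b)" "linear (\<lambda>b. dgram c p k a b)"
    "dgram c p k a b = dgram c p k b a"
proof -
  show "linear (\<lambda>k. dgram c p k a b)" for a b
    by (rule has_derivative_linear[OF has_derivative_gram[OF c]])
  show sym: "dgram c p k a b = dgram c p k b a" for k a b
  proof -
    have "((\<lambda>y. gram c (chart_inv c y) b a) has_derivative (\<lambda>k. dgram c p k a b)) (at (snd c p))"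
      by (rule has_derivative_cong_chart[OF c open_UNIV UNIV_I has_derivative_gram[OF c]])
        (rule inner_form.sym[OF inner_form_gram])
    from has_derivative_unique[OF this has_derivative_gram[OF c]] show ?thesis by metis
  qed
  show lin: "linear (\<lambda>a. dgram c p k a b)" for k b
  proof (rule linearI)
    have bil: "bilinear (gram c (chart_inv c y))" if "c \<in> charts_at A (chart_inv c y)" for y
      using inner_form_gram[OF that] unfolding inner_form_def by blast
    show "dgram c p k (a + a') b = dgram c p k a b + dgram c p k a' b" for a a'
    proof -
      have "((\<lambda>y. gram c (chart_inv c y) (a + a') b) has_derivative
          (\<lambda>k. dgram c p k a b + dgram c p k a' b)) (at (snd c p))"
        by (rule has_derivative_cong_chart[OF c open_UNIV UNIV_I has_derivative_add[OF
              has_derivative_gram[OF c, of a b] has_derivative_gram[OF c, of a' b]]])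
          (simp add: bilinear_ladd[OF bil])
      from has_derivative_unique[OF this has_derivative_gram[OF c]] show ?thesis by metis
    qed
    show "dgram c p k (r *\<^sub>R a) b = r *\<^sub>R dgram c p k a b" for r a
    proof -
      have "((\<lambda>y. gram c (chart_inv c y) (r *\<^sub>R a) b) has_derivative
          (\<lambda>k. r *\<^sub>R dgram c p k a b)) (at (snd c p))"
        by (rule has_derivative_cong_chart[OF c open_UNIV UNIV_I has_derivative_scaleR_right[OF
              has_derivative_gram[OF c, of a b]]])
          (simp add: bilinear_lmul[OF bil])
      from has_derivative_unique[OF this has_derivative_gram[OF c]] show ?thesis by metis
    qed
  qed
  show "linear (\<lambda>b. dgram c p k a b)" using lin[of k a] by (simp add: sym)
qed

lemma dir_deriv_gram:
  assumes c: "c \<in> charts_at A p"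
  shows "dir_deriv A p (coord_field A c k p) (\<lambda>q. g q (coord_field A c a q) (coord_field A c b q)) =
    dgram c p k a b"
  using dir_deriv_eq[OF coord_field_tangent[OF c] c, of "\<lambda>q. gram c q a b", unfolded comp_def,
      OF has_derivative_gram[OF c]] c unfolding gram_def by simp

text \<open>Resolves the definite description. The last clause does not ask for bilinearity of the
  candidate, since Koszul's formula already determines it.\<close>

lemma levi_civita:
  assumes c: "c \<in> charts_at A p"
  shows "bilinear (levi_civita A g c p)" "levi_civita A g c p a b = levi_civita A g c p b a"
    "dgram c p k a b = gram c p (levi_civita A g c p k a) b + gram c p a (levi_civita A g c p k b)"
    "\<lbrakk>\<And>a b. \<Gamma> a b = \<Gamma> b a; \<And>k a b. dgram c p k a b = gram c p (\<Gamma> k a) b + gram c p a (\<Gamma> k b)\<rbrakk>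
      \<Longrightarrow> levi_civita A g c p = \<Gamma>"
proof -
  interpret G: inner_form "gram c p" by (rule inner_form_gram[OF c])
  let ?P = "\<lambda>\<Gamma>. bilinear \<Gamma> \<and> (\<forall>a b. \<Gamma> a b = \<Gamma> b a) \<and>
    (\<forall>k a b. dgram c p k a b = gram c p (\<Gamma> k a) b + gram c p a (\<Gamma> k b))"
  obtain \<Gamma> where \<Gamma>: "?P \<Gamma>"
    using G.christoffel_exists[of "dgram c p", OF dgram_linear[OF c]] by blast
  have unique: "\<Gamma>' = \<Gamma>" if "?P \<Gamma>'" for \<Gamma>'
    by (rule G.christoffel_unique[of _ _ "dgram c p"]) (use \<Gamma> that in blast)+
  have "levi_civita A g c p = (THE \<Gamma>. ?P \<Gamma>)"
    unfolding levi_civita_def dir_deriv_gram[OF c] gram_def ..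
  also have "\<dots> = \<Gamma>" using \<Gamma> unique by (rule the_equality)
  finally have eq: "levi_civita A g c p = \<Gamma>" .
  show "bilinear (levi_civita A g c p)" "levi_civita A g c p a b = levi_civita A g c p b a"
    "dgram c p k a b = gram c p (levi_civita A g c p k a) b + gram c p a (levi_civita A g c p k b)"
    unfolding eq using \<Gamma> by blast+
  show "levi_civita A g c p = \<Gamma>'" if "\<And>a b. \<Gamma>' a b = \<Gamma>' b a"
    "\<And>k a b. dgram c p k a b = gram c p (\<Gamma>' k a) b + gram c p a (\<Gamma>' k b)" for \<Gamma>'
    unfolding eq by (rule G.christoffel_unique[of _ _ "dgram c p"]) (use \<Gamma> that in blast)+
qed

section \<open>Christoffel symbols under a change of coordinates\<close>

definition d2trans :: "('p, 'e) chart \<Rightarrow> ('p, 'e) chart \<Rightarrow> 'p \<Rightarrow> 'e \<Rightarrow> 'e \<Rightarrow> 'e" where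
  "d2trans c c' p k a = frechet_derivative
    (\<lambda>y. frechet_derivative (snd c' \<circ> chart_inv c) (at y) a) (at (snd c p)) k"

lemma d2trans:
  assumes c: "c \<in> charts_at A p" "c' \<in> charts_at A p"
  shows "((\<lambda>y. dtrans c c' (chart_inv c y) a) has_derivative (\<lambda>k. d2trans c c' p k a)) (at (snd c p))"
    "d2trans c c' p k a = d2trans c c' p a k"
proof -
  note cA = charts_atD(1)[OF c(1)] charts_atD(1)[OF c(2)]
  note sm = smooth_transition[OF cA] and c'p = charts_atD(2)[OF c(2)]
  have "((\<lambda>y. frechet_derivative (snd c' \<circ> chart_inv c) (at y) a) has_derivative (\<lambda>k. d2trans c c' p k a)) (at (snd c p))"
    unfolding d2trans_def
    by (rule smooth_on_has_derivative[OF smooth_on_frechet_derivative[OF sm] chart_imageI[OF c(1) c'p]])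
  then show "((\<lambda>y. dtrans c c' (chart_inv c y) a) has_derivative (\<lambda>k. d2trans c c' p k a)) (at (snd c p))"
    by (rule has_derivative_cong_chart[OF c(1) open_UNIV UNIV_I]) (simp add: dtrans_def)
  show "d2trans c c' p k a = d2trans c c' p a k"
    unfolding d2trans_def
    by (rule second_derivative_symmetric[OF sm open_chart_image[OF cA(1) open_chart_domain[OF cA(2)]]
          chart_imageI[OF c(1) c'p]])
qed

text \<open>The inhomogeneous law of the Christoffel symbols. Uniqueness reduces it to showing that
  the symbols predicted by the law are symmetric, which uses equality of mixed derivatives of the
  coordinate change, and compatible with the metric.\<close>

lemma levi_civita_transform:
  assumes c: "c \<in> charts_at A p" "c' \<in> charts_at A p"
  shows "dtrans c' c p (levi_civita A g c' p k a) =
    levi_civita A g c p (dtrans c' c p k) (dtrans c' c p a) + d2trans c' c p k a"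
proof -
  let ?s = "dtrans c' c p" and ?\<Gamma> = "levi_civita A g c p" and ?H = "d2trans c' c p"
  \<comment> \<open>The law solved for the symbols in \<open>c'\<close>: its right-hand side is
    carried back by the inverse Jacobian.\<close>
  define \<Gamma>' where "\<Gamma>' k a = dtrans c c' p (?\<Gamma> (?s k) (?s a) + ?H k a)" for k a
  have s\<Gamma>': "?s (\<Gamma>' k a) = ?\<Gamma> (?s k) (?s a) + ?H k a" for k a
    unfolding \<Gamma>'_def by (simp add: dtrans_dtrans[OF c(1,2,1)] dtrans_self[OF c(1)])
  have bil: "bilinear (gram c p)" using inner_form_gram[OF c(1)] unfolding inner_form_def by blast
  have "levi_civita A g c' p = \<Gamma>'"
  proof (rule levi_civita(4)[OF c(2)])
    show "\<Gamma>' a b = \<Gamma>' b a" for a b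
      unfolding \<Gamma>'_def using levi_civita(2)[OF c(1), of "?s a" "?s b"] d2trans(2)[OF c(2,1), of a b] by simp
    show "dgram c' p k a b = gram c' p (\<Gamma>' k a) b + gram c' p a (\<Gamma>' k b)" for k a b
    proof -
      let ?S = "snd c' ` (fst c' \<inter> fst c)"
      have near: "bilinear (gram c (chart_inv c' y))" if "y \<in> ?S" for y
      proof -
        have "c \<in> charts_at A (chart_inv c' y)"
          using chart_imageD(2)[OF charts_atD(1)[OF c(2)] that] charts_atD(1)[OF c(1)]
          by (simp add: charts_at_def)
        then show ?thesis using inner_form_gram unfolding inner_form_def by blast
      qed
      have "((\<lambda>y. gram c (chart_inv c' y) a b) has_derivative (\<lambda>k. dgram c p (?s k) a b)) (at (snd c' p))" for a b
        using has_derivative_change_chart[OF c(2,1), of "\<lambda>q. gram c q a b"] has_derivative_gram[OF c(1), of a b]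
        unfolding comp_def by blast
      \<comment> \<open>The vectors \<open>a\<close> and \<open>b\<close>, constant in
        \<open>c'\<close>, have varying components in \<open>c\<close>; the two terms with
        \<open>?H\<close> record this variation.\<close>
      from has_derivative_bilinear_family[OF open_chart_image[OF charts_atD(1)[OF c(2)]
            open_chart_domain[OF charts_atD(1)[OF c(1)]]] chart_imageI[OF c(2) charts_atD(2)[OF c(1)]]
          near this d2trans(1)[OF c(2,1), of a] d2trans(1)[OF c(2,1), of b]]
      have "((\<lambda>y. gram c (chart_inv c' y) (dtrans c' c (chart_inv c' y) a) (dtrans c' c (chart_inv c' y) b))
        has_derivative (\<lambda>k. dgram c p (?s k) (?s a) (?s b) + gram c p (?H k a) (?s b) + gram c p (?s a) (?H k b)))
        (at (snd c' p))"
        using c by simp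
      then have "((\<lambda>y. gram c' (chart_inv c' y) a b)
        has_derivative (\<lambda>k. dgram c p (?s k) (?s a) (?s b) + gram c p (?H k a) (?s b) + gram c p (?s a) (?H k b)))
        (at (snd c' p))"
      proof (rule has_derivative_cong_chart[OF c(2) open_chart_domain[OF charts_atD(1)[OF c(1)]] charts_atD(2)[OF c(1)]])
        fix y assume "c' \<in> charts_at A (chart_inv c' y)" "chart_inv c' y \<in> fst c"
        then show "gram c (chart_inv c' y) (dtrans c' c (chart_inv c' y) a) (dtrans c' c (chart_inv c' y) b) =
            gram c' (chart_inv c' y) a b"
          using charts_atD(1)[OF c(1)] by (intro gram_transform[symmetric]) (simp_all add: charts_at_def)
      qed
      from has_derivative_unique[OF has_derivative_gram[OF c(2)] this]
      have "dgram c' p k a b = dgram c p (?s k) (?s a) (?s b) + gram c p (?H k a) (?s b) + gram c p (?s a) (?H k b)"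
        by metis
      then show ?thesis
        unfolding gram_transform[OF c] s\<Gamma>' levi_civita(3)[OF c(1)] bilinear_ladd[OF bil] bilinear_radd[OF bil]
        by simp
    qed
  qed
  then show ?thesis using s\<Gamma>' by simp
qed

end

section \<open>Sections along a map\<close>

locale map_into_riemannian = A: manifold A + B: riemannian_manifold B h
  for A :: "('p::{t2_space, second_countable_topology}, 'e::euclidean_space) chart set"
    and B :: "('q::{t2_space, second_countable_topology}, 'f::euclidean_space) chart set"
    and h +
  fixes u :: "'p \<Rightarrow> 'q"
  assumes smooth_map: "smooth_map A B u"
begin

definition jac :: "('p, 'e) chart \<Rightarrow> ('q, 'f) chart \<Rightarrow> 'p \<Rightarrow> 'e \<Rightarrow> 'f" where
  "jac c d p = frechet_derivative (snd d \<circ> u \<circ> chart_inv c) (at (snd c p))"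

text \<open>The ordinary second derivative of \<open>u\<close> in coordinates; it becomes tensorial
  only after both connections are taken into account.\<close>

definition hess :: "('p, 'e) chart \<Rightarrow> ('q, 'f) chart \<Rightarrow> 'p \<Rightarrow> 'e \<Rightarrow> 'e \<Rightarrow> 'f" where
  "hess c d p k a = frechet_derivative
    (\<lambda>y. frechet_derivative (snd d \<circ> u \<circ> chart_inv c) (at y) a) (at (snd c p)) k"

lemma open_preimage: "open S \<Longrightarrow> open (u -` S)"
  using smooth_map unfolding smooth_map_def by (simp add: open_vimage)

lemma smooth_representation:
  "c \<in> A \<Longrightarrow> d \<in> B \<Longrightarrow> smooth_on (snd d \<circ> u \<circ> chart_inv c) (snd c ` (fst c \<inter> u -` fst d))"
  using smooth_map unfolding smooth_map_def by blast

lemma open_chart_preimage: "d \<in> charts_at B (u p) \<Longrightarrow> open (u -` fst d)"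
  by (rule open_preimage[OF B.open_chart_domain[OF B.charts_atD(1)]])

lemma in_chart_preimage: "d \<in> charts_at B (u p) \<Longrightarrow> p \<in> u -` fst d"
  using B.charts_atD(2) by simp

lemma charts_at_preimage: "d \<in> charts_at B (u p) \<Longrightarrow> q \<in> u -` fst d \<Longrightarrow> d \<in> charts_at B (u q)"
  unfolding charts_at_def by simp

lemma has_derivative_jac:
  assumes c: "c \<in> charts_at A p" and d: "d \<in> charts_at B (u p)"
  shows "((snd d \<circ> u \<circ> chart_inv c) has_derivative jac c d p) (at (snd c p))"
  unfolding jac_def
  by (rule smooth_on_has_derivative[OF smooth_representation[OF A.charts_atD(1)[OF c] B.charts_atD(1)[OF d]]
        A.chart_imageI[OF c in_chart_preimage[OF d]]])

lemma linear_jac: "c \<in> charts_at A p \<Longrightarrow> d \<in> charts_at B (u p) \<Longrightarrow> linear (jac c d p)"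
  using has_derivative_jac has_derivative_linear by blast

lemma hess:
  assumes c: "c \<in> charts_at A p" and d: "d \<in> charts_at B (u p)"
  shows "((\<lambda>y. jac c d (chart_inv c y) a) has_derivative (\<lambda>k. hess c d p k a)) (at (snd c p))"
    "hess c d p k a = hess c d p a k"
proof -
  note sm = smooth_representation[OF A.charts_atD(1)[OF c] B.charts_atD(1)[OF d]]
    and p = A.chart_imageI[OF c in_chart_preimage[OF d]]
  have "((\<lambda>y. frechet_derivative (snd d \<circ> u \<circ> chart_inv c) (at y) a) has_derivative (\<lambda>k. hess c d p k a)) (at (snd c p))"
    unfolding hess_def by (rule smooth_on_has_derivative[OF smooth_on_frechet_derivative[OF sm] p])
  then show "((\<lambda>y. jac c d (chart_inv c y) a) has_derivative (\<lambda>k. hess c d p k a)) (at (snd c p))"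
    by (rule A.has_derivative_cong_chart[OF c open_UNIV UNIV_I]) (simp add: jac_def)
  show "hess c d p k a = hess c d p a k"
    unfolding hess_def
    by (rule second_derivative_symmetric[OF sm A.open_chart_image[OF A.charts_atD(1)[OF c] open_chart_preimage[OF d]] p])
qed

text \<open>The chain rule through \<open>d\<close> describes \<open>f\<close> along
  \<open>u\<close> only where \<open>u\<close> stays in the domain of \<open>d\<close>; continuity
  of \<open>u\<close> makes this a neighbourhood of \<open>p\<close>.\<close>

lemma has_derivative_along:
  assumes c: "c \<in> charts_at A p" and d: "d \<in> charts_at B (u p)"
    and f: "((f \<circ> chart_inv d) has_derivative f') (at (snd d (u p)))"
  shows "((f \<circ> u \<circ> chart_inv c) has_derivative (\<lambda>a. f' (jac c d p a))) (at (snd c p))"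
proof (rule A.has_derivative_cong_chart[OF c open_chart_preimage[OF d] in_chart_preimage[OF d]])
  have "((f \<circ> chart_inv d) has_derivative f') (at ((snd d \<circ> u \<circ> chart_inv c) (snd c p)))"
    using f c by simp
  then show "((f \<circ> chart_inv d \<circ> (snd d \<circ> u \<circ> chart_inv c)) has_derivative (\<lambda>a. f' (jac c d p a))) (at (snd c p))"
    using diff_chain_at[OF has_derivative_jac[OF c d]] unfolding comp_def by blast
  show "(f \<circ> chart_inv d \<circ> (snd d \<circ> u \<circ> chart_inv c)) y = (f \<circ> u \<circ> chart_inv c) y"
    if "chart_inv c y \<in> u -` fst d" for y
    using B.chart_inv_chart[OF charts_at_preimage[OF d that]] by simp
qed

lemma differential_eq:
  assumes v: "v \<in> tangent_space A p" and c: "c \<in> charts_at A p" and d: "d \<in> charts_at B (u p)"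
  shows "differential A B u p v d = jac c d p (v c)"
  unfolding differential_def using A.dir_deriv_eq[OF v c has_derivative_jac[OF c d]] d by simp

lemma jac_transform:
  assumes c: "c \<in> charts_at A p" and d: "d \<in> charts_at B (u p)" "d' \<in> charts_at B (u p)"
  shows "jac c d' p a = B.dtrans d d' (u p) (jac c d p a)"
  using has_derivative_unique[OF has_derivative_jac[OF c d(2)]
      has_derivative_along[OF c d(1) B.has_derivative_transition[OF d]]] by metis

lemma differential_tangent:
  assumes v: "v \<in> tangent_space A p"
  shows "differential A B u p v \<in> tangent_space B (u p)"
proof -
  obtain c where c: "c \<in> charts_at A p" using A.ex_chart by blast
  obtain d where d: "d \<in> charts_at B (u p)" using B.ex_chart by blast
  show ?thesis
  proof (rule B.tangentI[OF d])
    show "differential A B u p v d' = B.dtrans d d' (u p) (differential A B u p v d)"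
      if d': "d' \<in> charts_at B (u p)" for d'
      unfolding differential_eq[OF v c d] differential_eq[OF v c d'] by (rule jac_transform[OF c d d'])
  qed (simp add: differential_def)
qed

lemma differential_sum:
  assumes v: "\<And>i. i \<in> I \<Longrightarrow> v i \<in> tangent_space A p"
  shows "differential A B u p (\<lambda>c. \<Sum>i\<in>I. r i *\<^sub>R v i c) = (\<lambda>d. \<Sum>i\<in>I. r i *\<^sub>R differential A B u p (v i) d)"
proof
  fix d
  obtain c where c: "c \<in> charts_at A p" using A.ex_chart by blast
  show "differential A B u p (\<lambda>c. \<Sum>i\<in>I. r i *\<^sub>R v i c) d = (\<Sum>i\<in>I. r i *\<^sub>R differential A B u p (v i) d)"
  proof (cases "d \<in> charts_at B (u p)")
    case True
    have "differential A B u p (\<lambda>c. \<Sum>i\<in>I. r i *\<^sub>R v i c) d = jac c d p (\<Sum>i\<in>I. r i *\<^sub>R v i c)"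
      by (rule differential_eq[OF _ c True]) (intro A.tangent_sum A.tangent_scaleR v)
    also have "\<dots> = (\<Sum>i\<in>I. r i *\<^sub>R differential A B u p (v i) d)"
      by (simp add: linear_sum[OF linear_jac[OF c True]] linear_cmul[OF linear_jac[OF c True]]
          differential_eq[OF v c True])
    finally show ?thesis .
  qed (simp add: differential_def)
qed

text \<open>Tangency is required near \<open>p\<close>, since component and metric identities get
  differentiated; differentiability is required only at \<open>p\<close>, since a connection uses
  first derivatives there.\<close>

definition differentiable_section :: "'p \<Rightarrow> ('p \<Rightarrow> ('q, 'f) tvec) \<Rightarrow> bool" where
  "differentiable_section p V \<longleftrightarrow> (\<exists>S. open S \<and> p \<in> S \<and> (\<forall>q\<in>S. V q \<in> tangent_space B (u q))) \<and>
     (\<forall>d\<in>charts_at B (u p). A.differentiable_fun p (\<lambda>q. V q d))"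

lemma section_tangent: "differentiable_section p V \<Longrightarrow> V p \<in> tangent_space B (u p)"
  unfolding differentiable_section_def by blast

lemma section_differentiable:
  "differentiable_section p V \<Longrightarrow> d \<in> charts_at B (u p) \<Longrightarrow> A.differentiable_fun p (\<lambda>q. V q d)"
  unfolding differentiable_section_def by blast

lemma has_derivative_section:
  assumes V: "differentiable_section p V" and c: "c \<in> charts_at A p" and d: "d \<in> charts_at B (u p)"
  shows "((\<lambda>y. V (chart_inv c y) d) has_derivative
    (\<lambda>k. dir_deriv A p (coord_field A c k p) (\<lambda>q. V q d))) (at (snd c p))"
  using A.has_dir_deriv[OF section_differentiable[OF V d] c] unfolding comp_def .

lemma nabla_along_eq:
  assumes v: "v \<in> tangent_space A p" and c: "c \<in> charts_at A p" and d: "d \<in> charts_at B (u p)"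
  shows "nabla_along A B h u p v V d =
    dir_deriv A p v (\<lambda>q. V q d) + levi_civita B h d (u p) (jac c d p (v c)) (V p d)"
  unfolding nabla_along_def using d differential_eq[OF v c d] by simp

text \<open>Differentiating the component law of \<open>V\<close> produces a second derivative of
  the coordinate change. It is exactly the inhomogeneous term of
  \<open>levi_civita_transform\<close>, so the covariant derivative transforms by the Jacobian
  alone.\<close>

lemma nabla_along_tangent:
  assumes v: "v \<in> tangent_space A p" and V: "differentiable_section p V"
  shows "nabla_along A B h u p v V \<in> tangent_space B (u p)"
proof -
  obtain c where c: "c \<in> charts_at A p" using A.ex_chart by blast
  obtain d' where d': "d' \<in> charts_at B (u p)" using B.ex_chart by blast
  obtain S where S: "open S" "p \<in> S" "\<And>q. q \<in> S \<Longrightarrow> V q \<in> tangent_space B (u q)"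
    using V unfolding differentiable_section_def by blast
  show ?thesis
  proof (rule B.tangentI[OF d'])
    fix d assume d: "d \<in> charts_at B (u p)"
    let ?s = "B.dtrans d' d (u p)"
    \<comment> \<open>On this neighbourhood \<open>V\<close> is tangent and both target charts are
      available, so the component law holds at each point and may be differentiated.\<close>
    define O' where "O' = S \<inter> u -` fst d \<inter> u -` fst d'"
    have O': "open O'" "p \<in> O'"
      using S open_chart_preimage[OF d] open_chart_preimage[OF d'] in_chart_preimage[OF d]
        in_chart_preimage[OF d'] unfolding O'_def by auto
    note cA = A.charts_atD(1)[OF c]
    have charts: "d \<in> charts_at B (u (chart_inv c y))" "d' \<in> charts_at B (u (chart_inv c y))"
      "V (chart_inv c y) \<in> tangent_space B (u (chart_inv c y))" if "chart_inv c y \<in> O'" for y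
      using that S(3) charts_at_preimage[OF d] charts_at_preimage[OF d'] unfolding O'_def by auto
    have "((\<lambda>y. B.dtrans d' d (u (chart_inv c y)) a) has_derivative
        (\<lambda>k. B.d2trans d' d (u p) (jac c d' p k) a)) (at (snd c p))" for a
      using has_derivative_along[OF c d', of "\<lambda>q. B.dtrans d' d q a"] B.d2trans(1)[OF d' d, of a]
      unfolding comp_def by blast
    from has_derivative_linear_family[OF A.open_chart_image[OF cA O'(1)] A.chart_imageI[OF c O'(2)] _ this
        has_derivative_section[OF V c d'], OF B.linear_dtrans]
    have "((\<lambda>y. B.dtrans d' d (u (chart_inv c y)) (V (chart_inv c y) d')) has_derivative
        (\<lambda>k. B.d2trans d' d (u p) (jac c d' p k) (V p d') +
          ?s (dir_deriv A p (coord_field A c k p) (\<lambda>q. V q d')))) (at (snd c p))"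
      using charts A.chart_imageD(2)[OF cA] c by simp
    then have "((\<lambda>y. V (chart_inv c y) d) has_derivative
        (\<lambda>k. B.d2trans d' d (u p) (jac c d' p k) (V p d') +
          ?s (dir_deriv A p (coord_field A c k p) (\<lambda>q. V q d')))) (at (snd c p))"
      by (rule A.has_derivative_cong_chart[OF c O']) (rule B.tangent_transform[symmetric], rule charts, assumption,
          rule charts, assumption, rule charts)
    from A.dir_deriv_eq[OF v c, of "\<lambda>q. V q d", unfolded comp_def, OF this]
    have "dir_deriv A p v (\<lambda>q. V q d) = B.d2trans d' d (u p) (jac c d' p (v c)) (V p d') +
          ?s (dir_deriv A p v (\<lambda>q. V q d'))"
      by (simp add: A.dir_deriv_coord[OF v c])
    moreover have "V p d = ?s (V p d')"
      by (rule B.tangent_transform[OF section_tangent[OF V] d' d])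
    ultimately show "nabla_along A B h u p v V d = ?s (nabla_along A B h u p v V d')"
      unfolding nabla_along_eq[OF v c d] nabla_along_eq[OF v c d'] linear_add[OF B.linear_dtrans[OF d' d]]
        B.levi_civita_transform[OF d d'] jac_transform[OF c d' d] by simp
  qed (simp add: nabla_along_def)
qed

text \<open>In coordinates the derivative of the metric coefficients along \<open>u\<close> splits
  into two Christoffel terms, which complete the derivatives of the components of \<open>V\<close>
  and \<open>W\<close> to covariant ones.\<close>

lemma nabla_along_metric:
  assumes V: "differentiable_section p V" and W: "differentiable_section p W"
  shows "A.differentiable_fun p (\<lambda>q. h (u q) (V q) (W q))"
    "v \<in> tangent_space A p \<Longrightarrow> dir_deriv A p v (\<lambda>q. h (u q) (V q) (W q)) =
      h (u p) (nabla_along A B h u p v V) (W p) + h (u p) (V p) (nabla_along A B h u p v W)"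
proof -
  obtain c where c: "c \<in> charts_at A p" using A.ex_chart by blast
  obtain d where d: "d \<in> charts_at B (u p)" using B.ex_chart by blast
  obtain S1 where S1: "open S1" "p \<in> S1" "\<And>q. q \<in> S1 \<Longrightarrow> V q \<in> tangent_space B (u q)"
    using V unfolding differentiable_section_def by blast
  obtain S2 where S2: "open S2" "p \<in> S2" "\<And>q. q \<in> S2 \<Longrightarrow> W q \<in> tangent_space B (u q)"
    using W unfolding differentiable_section_def by blast
  define O' where "O' = S1 \<inter> S2 \<inter> u -` fst d"
  have O': "open O'" "p \<in> O'"
    using S1 S2 open_chart_preimage[OF d] in_chart_preimage[OF d] unfolding O'_def by auto
  note cA = A.charts_atD(1)[OF c]
  have dq: "d \<in> charts_at B (u q)" if "q \<in> O'" for q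
    using that charts_at_preimage[OF d] unfolding O'_def by auto
  have bil: "bilinear (B.gram d (u q))" if "q \<in> O'" for q
    using B.inner_form_gram[OF dq[OF that]] unfolding inner_form_def by blast
  have "((\<lambda>y. B.gram d (u (chart_inv c y)) a b) has_derivative
      (\<lambda>k. B.dgram d (u p) (jac c d p k) a b)) (at (snd c p))" for a b
    using has_derivative_along[OF c d, of "\<lambda>q. B.gram d q a b"] B.has_derivative_gram[OF d, of a b]
    unfolding comp_def by blast
  from has_derivative_bilinear_family[OF A.open_chart_image[OF cA O'(1)] A.chart_imageI[OF c O'(2)] _ this
      has_derivative_section[OF V c d] has_derivative_section[OF W c d], OF bil[OF A.chart_imageD(2)[OF cA]]]
  have "((\<lambda>y. B.gram d (u (chart_inv c y)) (V (chart_inv c y) d) (W (chart_inv c y) d)) has_derivative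
      (\<lambda>k. B.dgram d (u p) (jac c d p k) (V p d) (W p d) +
        B.gram d (u p) (dir_deriv A p (coord_field A c k p) (\<lambda>q. V q d)) (W p d) +
        B.gram d (u p) (V p d) (dir_deriv A p (coord_field A c k p) (\<lambda>q. W q d)))) (at (snd c p))"
    using c by simp
  then have D: "((\<lambda>y. h (u (chart_inv c y)) (V (chart_inv c y)) (W (chart_inv c y))) has_derivative
      (\<lambda>k. B.dgram d (u p) (jac c d p k) (V p d) (W p d) +
        B.gram d (u p) (dir_deriv A p (coord_field A c k p) (\<lambda>q. V q d)) (W p d) +
        B.gram d (u p) (V p d) (dir_deriv A p (coord_field A c k p) (\<lambda>q. W q d)))) (at (snd c p))"
  proof (rule A.has_derivative_cong_chart[OF c O'])
    fix y assume y: "chart_inv c y \<in> O'"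
    then have "V (chart_inv c y) \<in> tangent_space B (u (chart_inv c y))" "W (chart_inv c y) \<in> tangent_space B (u (chart_inv c y))"
      using S1(3) S2(3) unfolding O'_def by auto
    then show "B.gram d (u (chart_inv c y)) (V (chart_inv c y) d) (W (chart_inv c y) d) =
        h (u (chart_inv c y)) (V (chart_inv c y)) (W (chart_inv c y))"
      by (rule B.metric_eq_gram[OF _ _ dq[OF y], symmetric])
  qed
  note r = A.has_dir_deriv_rule[OF c, of "\<lambda>q. h (u q) (V q) (W q)", unfolded comp_def, OF D]
  show "A.differentiable_fun p (\<lambda>q. h (u q) (V q) (W q))" by (rule r)
  assume v: "v \<in> tangent_space A p"
  have bilp: "bilinear (B.gram d (u p))" by (rule bil[OF O'(2)])
  show "dir_deriv A p v (\<lambda>q. h (u q) (V q) (W q)) =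
      h (u p) (nabla_along A B h u p v V) (W p) + h (u p) (V p) (nabla_along A B h u p v W)"
    unfolding r(2)[OF v] A.dir_deriv_coord[OF v c] B.levi_civita(3)[OF d]
      B.metric_eq_gram[OF nabla_along_tangent[OF v V] section_tangent[OF W] d]
      B.metric_eq_gram[OF section_tangent[OF V] nabla_along_tangent[OF v W] d]
      nabla_along_eq[OF v c d] bilinear_ladd[OF bilp] bilinear_radd[OF bilp] by simp
qed

text \<open>Additivity and the Leibniz rule together, in the form in which \<open>sigma_F\<close> is
  a combination of the images of the frame with function coefficients.\<close>

lemma nabla_along_sum:
  fixes f :: "'i \<Rightarrow> 'p \<Rightarrow> real"
  assumes I: "finite I" and f: "\<And>i. i \<in> I \<Longrightarrow> A.differentiable_fun p (f i)"
    and V: "\<And>i. i \<in> I \<Longrightarrow> differentiable_section p (V i)"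
  shows "differentiable_section p (\<lambda>q d. \<Sum>i\<in>I. f i q *\<^sub>R V i q d)"
    "v \<in> tangent_space A p \<Longrightarrow> nabla_along A B h u p v (\<lambda>q d. \<Sum>i\<in>I. f i q *\<^sub>R V i q d) =
      (\<lambda>d. \<Sum>i\<in>I. dir_deriv A p v (f i) *\<^sub>R V i p d + f i p *\<^sub>R nabla_along A B h u p v (V i) d)"
proof -
  have "\<exists>S. open S \<and> p \<in> S \<and> (\<forall>q\<in>S. V i q \<in> tangent_space B (u q))" if "i \<in> I" for i
    using V[OF that] unfolding differentiable_section_def by blast
  then obtain S where S: "\<And>i. i \<in> I \<Longrightarrow> open (S i)" "\<And>i. i \<in> I \<Longrightarrow> p \<in> S i"
    "\<And>i q. i \<in> I \<Longrightarrow> q \<in> S i \<Longrightarrow> V i q \<in> tangent_space B (u q)" by metis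
  note diff = A.dir_deriv_scaleR[OF f section_differentiable[OF V]]
  note sum = A.dir_deriv_sum[of I p "\<lambda>i q. f i q *\<^sub>R V i q _", OF diff(1)]
  show "differentiable_section p (\<lambda>q d. \<Sum>i\<in>I. f i q *\<^sub>R V i q d)"
    unfolding differentiable_section_def
  proof (intro conjI ballI exI)
    \<comment> \<open>Finiteness of \<open>I\<close> makes the common domain of tangency
      open.\<close>
    show "open (\<Inter>i\<in>I. S i)" "p \<in> (\<Inter>i\<in>I. S i)" using S I by auto
    show "(\<lambda>d. \<Sum>i\<in>I. f i q *\<^sub>R V i q d) \<in> tangent_space B (u q)" if "q \<in> (\<Inter>i\<in>I. S i)" for q
      using that S(3) by (intro B.tangent_sum B.tangent_scaleR) auto
    show "A.differentiable_fun p (\<lambda>q. \<Sum>i\<in>I. f i q *\<^sub>R V i q d)" if "d \<in> charts_at B (u p)" for d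
      by (rule sum(1)) (use that in auto)
  qed
  assume v: "v \<in> tangent_space A p"
  obtain c where c: "c \<in> charts_at A p" using A.ex_chart by blast
  show "nabla_along A B h u p v (\<lambda>q d. \<Sum>i\<in>I. f i q *\<^sub>R V i q d) =
      (\<lambda>d. \<Sum>i\<in>I. dir_deriv A p v (f i) *\<^sub>R V i p d + f i p *\<^sub>R nabla_along A B h u p v (V i) d)"
  proof
    fix d
    show "nabla_along A B h u p v (\<lambda>q d. \<Sum>i\<in>I. f i q *\<^sub>R V i q d) d =
      (\<Sum>i\<in>I. dir_deriv A p v (f i) *\<^sub>R V i p d + f i p *\<^sub>R nabla_along A B h u p v (V i) d)"
    proof (cases "d \<in> charts_at B (u p)")
      case True
      let ?\<Gamma> = "levi_civita B h d (u p) (jac c d p (v c))"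
      have \<Gamma>: "linear ?\<Gamma>" using B.levi_civita(1)[OF True] unfolding bilinear_def by blast
      have "dir_deriv A p v (\<lambda>q. \<Sum>i\<in>I. f i q *\<^sub>R V i q d) =
          (\<Sum>i\<in>I. dir_deriv A p v (\<lambda>q. f i q *\<^sub>R V i q d))"
        by (rule sum(2)) (use True v in auto)
      also have "\<dots> = (\<Sum>i\<in>I. dir_deriv A p v (f i) *\<^sub>R V i p d + f i p *\<^sub>R dir_deriv A p v (\<lambda>q. V i q d))"
        by (rule sum.cong) (simp_all add: diff(2)[OF _ _ True v])
      finally show ?thesis
        unfolding nabla_along_eq[OF v c True] linear_sum[OF \<Gamma>] linear_cmul[OF \<Gamma>]
        by (simp add: sum.distrib scaleR_right_distrib)
    next
      case False
      then have "V i p d = 0" if "i \<in> I" for i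
        using B.tangent_outside[OF section_tangent[OF V[OF that]]] by blast
      then show ?thesis using False unfolding nabla_along_def by simp
    qed
  qed
qed

section \<open>Vector fields and their images under the differential\<close>

lemma has_derivative_field:
  assumes W: "smooth_field A U W" and p: "p \<in> U" and c: "c \<in> charts_at A p"
  shows "((\<lambda>y. W (chart_inv c y) c) has_derivative
    (\<lambda>k. dir_deriv A p (coord_field A c k p) (\<lambda>q. W q c))) (at (snd c p))"
proof -
  have "smooth_on (\<lambda>y. W (chart_inv c y) c) (snd c ` (fst c \<inter> U))"
    using W A.charts_atD(1)[OF c] unfolding smooth_field_def by blast
  then have "((\<lambda>q. W q c) \<circ> chart_inv c) differentiable (at (snd c p))"
    unfolding comp_def by (rule smooth_on_differentiable) (rule A.chart_imageI[OF c p])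
  from A.has_dir_deriv[OF A.differentiable_funI[OF c this] c] show ?thesis unfolding comp_def .
qed

text \<open>The product rule for the Jacobian of \<open>u\<close> applied to the components of
  \<open>W\<close>: the varying Jacobian gives \<open>hess\<close>, the varying components give the
  other term.\<close>

lemma differential_section:
  assumes W: "smooth_field A U W" and p: "p \<in> U"
  shows "differentiable_section p (\<lambda>q. differential A B u q (W q))"
    "\<lbrakk>v \<in> tangent_space A p; c \<in> charts_at A p; d \<in> charts_at B (u p)\<rbrakk> \<Longrightarrow>
      dir_deriv A p v (\<lambda>q. differential A B u q (W q) d) =
        hess c d p (v c) (W p c) + jac c d p (dir_deriv A p v (\<lambda>q. W q c))"
proof -
  have U: "open U" using W unfolding smooth_field_def by blast
  have D: "((\<lambda>y. differential A B u (chart_inv c y) (W (chart_inv c y)) d) has_derivative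
      (\<lambda>k. hess c d p k (W p c) + jac c d p (dir_deriv A p (coord_field A c k p) (\<lambda>q. W q c)))) (at (snd c p))"
    if c: "c \<in> charts_at A p" and d: "d \<in> charts_at B (u p)" for c d
  proof -
    define S where "S = U \<inter> u -` fst d"
    have S: "open S" "p \<in> S"
      using U p open_chart_preimage[OF d] in_chart_preimage[OF d] unfolding S_def by auto
    note cA = A.charts_atD(1)[OF c]
    have "linear (jac c d (chart_inv c y))" if "y \<in> snd c ` (fst c \<inter> S)" for y
      using A.chart_imageD(1,2)[OF cA that] charts_at_preimage[OF d] unfolding S_def
      by (intro linear_jac) auto
    from has_derivative_linear_family[OF A.open_chart_image[OF cA S(1)] A.chart_imageI[OF c S(2)] this
        hess(1)[OF c d] has_derivative_field[OF W p c]]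
    have "((\<lambda>y. jac c d (chart_inv c y) (W (chart_inv c y) c)) has_derivative
      (\<lambda>k. hess c d p k (W p c) + jac c d p (dir_deriv A p (coord_field A c k p) (\<lambda>q. W q c)))) (at (snd c p))"
      using c by simp
    then show ?thesis
    proof (rule A.has_derivative_cong_chart[OF c S])
      fix y assume y: "c \<in> charts_at A (chart_inv c y)" "chart_inv c y \<in> S"
      then show "jac c d (chart_inv c y) (W (chart_inv c y) c) =
          differential A B u (chart_inv c y) (W (chart_inv c y)) d"
        using A.smooth_field_tangent[OF W] charts_at_preimage[OF d] unfolding S_def
        by (intro differential_eq[symmetric]) auto
    qed
  qed
  note r = A.has_dir_deriv_rule[of _ p "\<lambda>q. differential A B u q (W q) _", unfolded comp_def, OF _ D]
  show "differentiable_section p (\<lambda>q. differential A B u q (W q))"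
    unfolding differentiable_section_def
  proof (intro conjI ballI exI)
    show "open U" "p \<in> U" by (rule U p)+
    show "differential A B u q (W q) \<in> tangent_space B (u q)" if "q \<in> U" for q
      by (rule differential_tangent[OF A.smooth_field_tangent[OF W that]])
    show "A.differentiable_fun p (\<lambda>q. differential A B u q (W q) d)" if d: "d \<in> charts_at B (u p)" for d
    proof -
      obtain c where c: "c \<in> charts_at A p" using A.ex_chart by blast
      show ?thesis by (rule r(1)[OF c c d])
    qed
  qed
  show "dir_deriv A p v (\<lambda>q. differential A B u q (W q) d) =
        hess c d p (v c) (W p c) + jac c d p (dir_deriv A p v (\<lambda>q. W q c))"
    if "v \<in> tangent_space A p" "c \<in> charts_at A p" "d \<in> charts_at B (u p)"
    unfolding r(2)[OF that(2,2,3,1)] A.dir_deriv_coord[OF that(1,2)] ..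
qed

end

section \<open>The second fundamental form and the stress-energy tensor\<close>

locale riemannian_map = map_into_riemannian A B h u + A: riemannian_manifold A g
  for A :: "('p::{t2_space, second_countable_topology}, 'e::euclidean_space) chart set"
    and B :: "('q::{t2_space, second_countable_topology}, 'f::euclidean_space) chart set"
    and g h u
begin

text \<open>With the identity as the map, the connection of the domain is itself a connection along
  a map, so tangency and metric compatibility of \<open>nabla\<close> become instances of the
  results for \<open>nabla_along\<close>.\<close>

lemma map_into_riemannian_id: "map_into_riemannian A A g id"
proof
  show "smooth_map A A id"
    unfolding smooth_map_def using A.smooth_transition by (simp add: continuous_on_id)
qed

lemma field_section:
  assumes W: "smooth_field A U W" and p: "p \<in> U"
  shows "map_into_riemannian.differentiable_section A A id p W"
proof -
  interpret id: map_into_riemannian A A g id by (rule map_into_riemannian_id)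
  have "A.differentiable_fun p (\<lambda>q. W q c)" if c: "c \<in> charts_at A p" for c
    using A.differentiable_funI[OF c, of "\<lambda>q. W q c"] has_derivative_field[OF W p c]
    unfolding differentiable_def comp_def by blast
  then show ?thesis
    unfolding id.differentiable_section_def using W p unfolding smooth_field_def by auto
qed

lemma nabla_eq_nabla_along_id:
  assumes v: "v \<in> tangent_space A p"
  shows "nabla A g p v W = nabla_along A A g id p v W"
proof -
  have "dir_deriv A p v (snd c) = v c" if c: "c \<in> charts_at A p" for c
    using A.dir_deriv_eq[OF v c A.has_derivative_transition[OF c c]] A.dtrans_self[OF c] by simp
  then show ?thesis unfolding nabla_def nabla_along_def differential_def by auto
qed

lemma nabla_tangent:
  assumes v: "v \<in> tangent_space A p" and W: "smooth_field A U W" and p: "p \<in> U"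
  shows "nabla A g p v W \<in> tangent_space A p"
proof -
  interpret id: map_into_riemannian A A g id by (rule map_into_riemannian_id)
  show ?thesis unfolding nabla_eq_nabla_along_id[OF v]
    using id.nabla_along_tangent[OF v field_section[OF W p]] by simp
qed

lemma nabla_metric:
  assumes W: "smooth_field A U W" "p \<in> U" and Z: "smooth_field A U' Z" "p \<in> U'"
  shows "A.differentiable_fun p (\<lambda>q. g q (W q) (Z q))"
    "v \<in> tangent_space A p \<Longrightarrow>
      dir_deriv A p v (\<lambda>q. g q (W q) (Z q)) = g p (nabla A g p v W) (Z p) + g p (W p) (nabla A g p v Z)"
proof -
  interpret id: map_into_riemannian A A g id by (rule map_into_riemannian_id)
  show "A.differentiable_fun p (\<lambda>q. g q (W q) (Z q))"
    using id.nabla_along_metric(1)[OF field_section[OF W] field_section[OF Z]] by simp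
  show "dir_deriv A p v (\<lambda>q. g q (W q) (Z q)) = g p (nabla A g p v W) (Z p) + g p (W p) (nabla A g p v Z)"
    if v: "v \<in> tangent_space A p"
    using id.nabla_along_metric(2)[OF field_section[OF W] field_section[OF Z] v]
    unfolding nabla_eq_nabla_along_id[OF v] by simp
qed

text \<open>The form \<open>\<nabla>du\<close>, computed in an arbitrarily chosen chart of the domain.\<close>

definition second_fundamental_form :: "'p \<Rightarrow> ('p, 'e) tvec \<Rightarrow> ('p, 'e) tvec \<Rightarrow> ('q, 'f) tvec" where
  "second_fundamental_form p v w = (\<lambda>d. if d \<in> charts_at B (u p)
     then (let c = SOME c. c \<in> charts_at A p in
       hess c d p (v c) (w c) - jac c d p (levi_civita A g c p (v c) (w c)) +
       levi_civita B h d (u p) (jac c d p (v c)) (jac c d p (w c)))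
     else 0)"

text \<open>Each of the three terms is symmetric: the Hessian by Schwarz's theorem, the others
  because both connections are torsion-free.\<close>

lemma second_fundamental_form_sym: "second_fundamental_form p v w = second_fundamental_form p w v"
proof -
  define c where "c = (SOME c. c \<in> charts_at A p)"
  have c: "c \<in> charts_at A p" unfolding c_def by (rule someI_ex[OF A.ex_chart])
  show ?thesis
    unfolding second_fundamental_form_def c_def[symmetric] Let_def
    using hess(2)[OF c, of _ "v c" "w c"] A.levi_civita(2)[OF c, of "v c" "w c"]
      B.levi_civita(2)[of _ "u p" "jac c _ p (v c)" "jac c _ p (w c)"] by auto
qed

text \<open>The Christoffel term of the domain, subtracted inside
  \<open>second_fundamental_form\<close>, is what the derivative of the components of
  \<open>W\<close> lacks to become \<open>nabla A g p v W\<close>.\<close>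

lemma nabla_along_differential:
  assumes v: "v \<in> tangent_space A p" and W: "smooth_field A U W" "p \<in> U"
  shows "nabla_along A B h u p v (\<lambda>q. differential A B u q (W q)) =
    (\<lambda>d. differential A B u p (nabla A g p v W) d + second_fundamental_form p v (W p) d)"
proof
  fix d
  define c where "c = (SOME c. c \<in> charts_at A p)"
  have c: "c \<in> charts_at A p" unfolding c_def by (rule someI_ex[OF A.ex_chart])
  show "nabla_along A B h u p v (\<lambda>q. differential A B u q (W q)) d =
    differential A B u p (nabla A g p v W) d + second_fundamental_form p v (W p) d"
  proof (cases "d \<in> charts_at B (u p)")
    case True
    have "nabla A g p v W c = dir_deriv A p v (\<lambda>q. W q c) + levi_civita A g c p (v c) (W p c)"
      unfolding nabla_def using c by simp
    then show ?thesis
      unfolding nabla_along_eq[OF v c True] differential_section(2)[OF W v c True]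
        differential_eq[OF nabla_tangent[OF v W] c True]
        differential_eq[OF A.smooth_field_tangent[OF W] c True]
        second_fundamental_form_def c_def[symmetric] Let_def
      using True by (simp add: linear_add[OF linear_jac[OF c True]])
  qed (simp add: nabla_along_def differential_def second_fundamental_form_def)
qed

text \<open>Tangency is not visible from the formula in coordinates, but the form is the difference
  of two tangent vectors; a field through the second argument is needed for this.\<close>

lemma second_fundamental_form_tangent:
  assumes v: "v \<in> tangent_space A p" and W: "smooth_field A U W" "p \<in> U"
  shows "second_fundamental_form p v (W p) \<in> tangent_space B (u p)"
proof -
  have "second_fundamental_form p v (W p) = (\<lambda>d. nabla_along A B h u p v (\<lambda>q. differential A B u q (W q)) d
      - differential A B u p (nabla A g p v W) d)"
    unfolding nabla_along_differential[OF v W] by simp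
  then show ?thesis
    using B.tangent_diff[OF nabla_along_tangent[OF v differential_section(1)[OF W]]
        differential_tangent[OF nabla_tangent[OF v W]]] by simp
qed

end

section \<open>Computations in an orthonormal frame\<close>

locale stress_energy_frame = riemannian_map A B g h u
  for A :: "('p::{t2_space, second_countable_topology}, 'e::euclidean_space) chart set"
    and B :: "('q::{t2_space, second_countable_topology}, 'f::euclidean_space) chart set"
    and g h u +
  fixes F F' F'' :: "real \<Rightarrow> real" and U :: "'p set" and e :: "nat \<Rightarrow> 'p \<Rightarrow> ('p, 'e) tvec"
  assumes F: "t \<ge> 0 \<Longrightarrow> (F has_real_derivative F' t) (at t within {0..})"
    and F': "t \<ge> 0 \<Longrightarrow> (F' has_real_derivative F'' t) (at t within {0..})"
    and frame: "orthonormal_frame A g U e"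
begin

abbreviation du :: "'p \<Rightarrow> ('p, 'e) tvec \<Rightarrow> ('q, 'f) tvec" where "du \<equiv> differential A B u"
abbreviation E :: "nat \<Rightarrow> 'p \<Rightarrow> ('q, 'f) tvec" where "E i q \<equiv> du q (e i q)"
abbreviation D :: "'p \<Rightarrow> ('p, 'e) tvec \<Rightarrow> nat \<Rightarrow> ('q, 'f) tvec" where
  "D p v i \<equiv> nabla_along A B h u p v (E i)"
abbreviation \<phi> :: "'p \<Rightarrow> real" where "\<phi> q \<equiv> pullback_norm2 A B h u e q / 4"
abbreviation T where "T \<equiv> stress_energy A B g h u e F F'"
abbreviation sff where "sff \<equiv> second_fundamental_form"

lemma frame_field: "i \<in> {1..DIM('e)} \<Longrightarrow> smooth_field A U (e i)"
  using frame unfolding orthonormal_frame_def by blast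

lemma frame_tangent: "i \<in> {1..DIM('e)} \<Longrightarrow> p \<in> U \<Longrightarrow> e i p \<in> tangent_space A p"
  by (rule A.smooth_field_tangent[OF frame_field])

lemma open_frame_domain: "open U"
proof -
  have "(1::nat) \<in> {1..DIM('e)}" using DIM_positive[where 'a='e] by simp
  then show ?thesis using frame_field unfolding smooth_field_def by blast
qed

lemma frame_orthonormal:
  "i \<in> {1..DIM('e)} \<Longrightarrow> j \<in> {1..DIM('e)} \<Longrightarrow> p \<in> U \<Longrightarrow> g p (e i p) (e j p) = (if i = j then 1 else 0)"
  using frame unfolding orthonormal_frame_def by blast

lemma frame_expansion:
  assumes p: "p \<in> U" and v: "v \<in> tangent_space A p"
  shows "v = (\<lambda>c. \<Sum>i = 1..DIM('e). g p v (e i p) *\<^sub>R e i p c)"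
proof -
  obtain c where c: "c \<in> charts_at A p" using A.ex_chart by blast
  interpret G: inner_form "A.gram c p" by (rule A.inner_form_gram[OF c])
  have gram: "g p w (e i p) = A.gram c p (w c) (e i p c)" if "i \<in> {1..DIM('e)}" "w \<in> tangent_space A p" for w i
    by (rule A.metric_eq_gram[OF that(2) frame_tangent[OF that(1) p] c])
  have "v c = (\<Sum>i = 1..DIM('e). A.gram c p (v c) (e i p c) *\<^sub>R e i p c)"
    by (rule G.orthonormal_expansion) (metis gram frame_tangent p frame_orthonormal)
  also have "\<dots> = (\<Sum>i = 1..DIM('e). g p v (e i p) *\<^sub>R e i p c)"
    by (rule sum.cong) (simp_all only: gram v)
  finally show ?thesis
    by (intro A.tangent_eqI[OF v _ c] A.tangent_sum A.tangent_scaleR frame_tangent p)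
qed

text \<open>Freezing the frame coefficients of \<open>v\<close> extends it to all of
  \<open>U\<close>. This lets pointwise statements be proved with fields and makes the description
  of \<open>nabla_tensor\<close> non-vacuous.\<close>

lemma extension_exists:
  assumes p: "p \<in> U" and v: "v \<in> tangent_space A p"
  shows "\<exists>W. smooth_field A U W \<and> W p = v"
proof (intro exI conjI)
  show "smooth_field A U (\<lambda>q c. \<Sum>i = 1..DIM('e). g p v (e i p) *\<^sub>R e i q c)"
    by (rule A.smooth_field_linear_combination[OF open_frame_domain frame_field])
  show "(\<lambda>c. \<Sum>i = 1..DIM('e). g p v (e i p) *\<^sub>R e i p c) = v" by (rule frame_expansion[OF p v, symmetric])
qed

lemma sff_tangent:
  assumes p: "p \<in> U" and v: "v \<in> tangent_space A p" and w: "w \<in> tangent_space A p"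
  shows "sff p v w \<in> tangent_space B (u p)"
  using extension_exists[OF p w] second_fundamental_form_tangent[OF v _ p] by metis

lemma E_section: "i \<in> {1..DIM('e)} \<Longrightarrow> p \<in> U \<Longrightarrow> differentiable_section p (E i)"
  by (rule differential_section(1)[OF frame_field])

lemma E_tangent: "i \<in> {1..DIM('e)} \<Longrightarrow> p \<in> U \<Longrightarrow> E i p \<in> tangent_space B (u p)"
  by (rule section_tangent[OF E_section])

lemma D_tangent: "i \<in> {1..DIM('e)} \<Longrightarrow> p \<in> U \<Longrightarrow> v \<in> tangent_space A p \<Longrightarrow> D p v i \<in> tangent_space B (u p)"
  by (rule nabla_along_tangent[OF _ E_section])

lemma sigma_metric:
  assumes p: "p \<in> U" and z: "z \<in> tangent_space B (u p)"
  shows "sigma A B h u e p w \<in> tangent_space B (u p)"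
    "h (u p) (sigma A B h u e p w) z = (\<Sum>j = 1..DIM('e). h (u p) (du p w) (E j p) * h (u p) (E j p) z)"
proof -
  show "sigma A B h u e p w \<in> tangent_space B (u p)"
    unfolding sigma_def by (intro B.tangent_sum B.tangent_scaleR E_tangent p)
  have "h (u p) (sigma A B h u e p w) z = (\<Sum>j = 1..DIM('e). h (u p) (\<lambda>d. h (u p) (du p w) (E j p) *\<^sub>R E j p d) z)"
    unfolding sigma_def by (rule B.metric_sum[OF _ z]) (intro B.tangent_scaleR E_tangent p)
  also have "\<dots> = (\<Sum>j = 1..DIM('e). h (u p) (du p w) (E j p) * h (u p) (E j p) z)"
    by (rule sum.cong[OF refl]) (rule B.metric_scaleR(1)[OF E_tangent[OF _ p] z])
  finally show "h (u p) (sigma A B h u e p w) z = (\<Sum>j = 1..DIM('e). h (u p) (du p w) (E j p) * h (u p) (E j p) z)" .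
qed

lemma stress_energy_eq:
  assumes p: "p \<in> U" and z: "z \<in> tangent_space A p"
  shows "T p w z = F (\<phi> p) * g p w z -
    F' (\<phi> p) * (\<Sum>j = 1..DIM('e). h (u p) (du p w) (E j p) * h (u p) (E j p) (du p z))"
  unfolding stress_energy_def sigma_metric(2)[OF p differential_tangent[OF z]] ..

lemma \<phi>_nonneg: "\<phi> q \<ge> 0"
  unfolding pullback_norm2_def by (simp add: sum_nonneg)

text \<open>The products of the frame fields are constant on \<open>U\<close>; the two sides are the
  terms in the derivative of such a product.\<close>

lemma frame_connection_antisym:
  assumes p: "p \<in> U" and v: "v \<in> tangent_space A p" and i: "i \<in> {1..DIM('e)}" and j: "j \<in> {1..DIM('e)}"
  shows "g p (nabla A g p v (e i)) (e j p) = - g p (nabla A g p v (e j)) (e i p)"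
proof -
  obtain c where c: "c \<in> charts_at A p" using A.ex_chart by blast
  let ?\<delta> = "(if i = j then 1 else 0) :: real"
  have const: "((\<lambda>q. ?\<delta>) \<circ> chart_inv c has_derivative (\<lambda>k. 0)) (at (snd c p))"
    unfolding comp_def by (rule has_derivative_const)
  have "dir_deriv A p v (\<lambda>q. g q (e i q) (e j q)) = dir_deriv A p v (\<lambda>q. ?\<delta>)"
    by (rule A.dir_deriv_cong(2)[OF open_frame_domain p _ A.has_dir_deriv_rule(1)[OF c const] v])
      (simp only: frame_orthonormal[OF i j])
  also have "\<dots> = 0" by (rule A.has_dir_deriv_rule(2)[OF c const v])
  finally have "g p (nabla A g p v (e i)) (e j p) + g p (e i p) (nabla A g p v (e j)) = 0"
    unfolding nabla_metric(2)[OF frame_field[OF i] p frame_field[OF j] p v] .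
  then show ?thesis
    using A.metric_sym[OF frame_tangent[OF i p] nabla_tangent[OF v frame_field[OF j] p]] by simp
qed

lemma D_eq:
  "i \<in> {1..DIM('e)} \<Longrightarrow> p \<in> U \<Longrightarrow> v \<in> tangent_space A p \<Longrightarrow>
    D p v i = (\<lambda>d. du p (nabla A g p v (e i)) d + sff p v (e i p) d)"
  by (rule nabla_along_differential[OF _ frame_field])

lemma E_metric_deriv:
  assumes p: "p \<in> U" and i: "i \<in> {1..DIM('e)}" and j: "j \<in> {1..DIM('e)}"
  shows "A.differentiable_fun p (\<lambda>q. h (u q) (E i q) (E j q))"
    "v \<in> tangent_space A p \<Longrightarrow> dir_deriv A p v (\<lambda>q. h (u q) (E i q) (E j q)) =
      h (u p) (D p v i) (E j p) + h (u p) (E i p) (D p v j)"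
  using nabla_along_metric[OF E_section[OF i p] E_section[OF j p]] by blast+

text \<open>Differentiating the squares yields derivatives of the frame images, each made of a
  second fundamental form and the image of the derivative of a frame field. Summation removes the
  latter, leaving an expression without derivatives of the frame.\<close>

lemma \<phi>_deriv:
  assumes p: "p \<in> U"
  shows "A.differentiable_fun p \<phi>"
    "v \<in> tangent_space A p \<Longrightarrow> dir_deriv A p v \<phi> =
      (\<Sum>i = 1..DIM('e). \<Sum>j = 1..DIM('e). h (u p) (E i p) (E j p) * h (u p) (E j p) (sff p v (e i p)))"
proof -
  let ?H = "\<lambda>i j q. h (u q) (E i q) (E j q)"
  let ?N = "pullback_norm2 A B h u e"
  have N: "?N = (\<lambda>q. \<Sum>i = 1..DIM('e). \<Sum>j = 1..DIM('e). ?H i j q * ?H i j q)"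
    unfolding pullback_norm2_def power2_eq_square ..
  note d0 = A.dir_deriv_mult[OF E_metric_deriv(1)[OF p] E_metric_deriv(1)[OF p]]
  have dj: "A.differentiable_fun p (\<lambda>q. \<Sum>j = 1..DIM('e). ?H i j q * ?H i j q)" if "i \<in> {1..DIM('e)}" for i
    by (rule A.dir_deriv_sum(1)[OF d0(1)[OF that _ that]])
  have dN: "A.differentiable_fun p ?N"
    unfolding N by (rule A.dir_deriv_sum(1)[OF dj])
  have quarter: "((\<lambda>t. t / 4) has_real_derivative 1 / 4) (at t within UNIV)" for t :: real
    by (auto intro!: derivative_eq_intros)
  show "A.differentiable_fun p \<phi>" by (rule A.dir_deriv_compose(1)[OF dN subset_UNIV quarter])
  assume v: "v \<in> tangent_space A p"
  let ?h = "\<lambda>i j. ?H i j p" and ?D = "\<lambda>i j. h (u p) (D p v i) (E j p)"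
    and ?S = "\<lambda>i j. h (u p) (E j p) (sff p v (e i p))"
    and ?\<omega> = "\<lambda>i l. g p (nabla A g p v (e i)) (e l p)"
  have hsym: "?h i j = ?h j i" if "i \<in> {1..DIM('e)}" "j \<in> {1..DIM('e)}" for i j
    by (rule B.metric_sym[OF E_tangent[OF that(1) p] E_tangent[OF that(2) p]])
  have "dir_deriv A p v \<phi> = 1 / 4 * dir_deriv A p v ?N"
    by (rule A.dir_deriv_compose(2)[OF dN subset_UNIV quarter v])
  also have "dir_deriv A p v ?N = (\<Sum>i = 1..DIM('e). dir_deriv A p v (\<lambda>q. \<Sum>j = 1..DIM('e). ?H i j q * ?H i j q))"
    unfolding N by (rule A.dir_deriv_sum(2)[OF dj v])
  also have "\<dots> = (\<Sum>i = 1..DIM('e). \<Sum>j = 1..DIM('e). dir_deriv A p v (\<lambda>q. ?H i j q * ?H i j q))"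
    by (rule sum.cong[OF refl]) (rule A.dir_deriv_sum(2)[OF d0(1) v])
  \<comment> \<open>The second summand is written with exchanged indices, so that swapping the sums
    makes it equal to the first; the resulting factor 4 cancels the one in
    \<open>\<phi>\<close>.\<close>
  also have "\<dots> = (\<Sum>i = 1..DIM('e). \<Sum>j = 1..DIM('e). 2 * (?h i j * ?D i j) + 2 * (?h j i * ?D j i))"
  proof (intro sum.cong refl)
    fix i j assume i: "i \<in> {1..DIM('e)}" and j: "j \<in> {1..DIM('e)}"
    show "dir_deriv A p v (\<lambda>q. ?H i j q * ?H i j q) = 2 * (?h i j * ?D i j) + 2 * (?h j i * ?D j i)"
      unfolding d0(2)[OF i j i j v] E_metric_deriv(2)[OF p i j v] hsym[OF j i]
        B.metric_sym[OF E_tangent[OF i p] D_tangent[OF j p v]] by (simp add: algebra_simps)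
  qed
  also have "\<dots> = 4 * (\<Sum>i = 1..DIM('e). \<Sum>j = 1..DIM('e). ?h i j * ?D i j)"
    unfolding sum.distrib sum_distrib_left[symmetric] by (subst (2) sum.swap) simp
  also have "1 / 4 * (4 * (\<Sum>i = 1..DIM('e). \<Sum>j = 1..DIM('e). ?h i j * ?D i j)) = (\<Sum>i = 1..DIM('e). \<Sum>j = 1..DIM('e). ?h i j * ?D i j)" by simp
  also have "\<dots> = (\<Sum>i = 1..DIM('e). \<Sum>j = 1..DIM('e). ?h i j * (\<Sum>l = 1..DIM('e). ?\<omega> i l * ?h l j) + ?h i j * ?S i j)"
  proof (intro sum.cong refl)
    fix i j assume i: "i \<in> {1..DIM('e)}" and j: "j \<in> {1..DIM('e)}"
    note n = nabla_tangent[OF v frame_field[OF i] p]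
    have "h (u p) (du p (nabla A g p v (e i))) (E j p) = h (u p) (\<lambda>d. \<Sum>l = 1..DIM('e). ?\<omega> i l *\<^sub>R E l p d) (E j p)"
      \<comment> \<open>Expanding the derivative of \<open>e i\<close> in the frame brings in the
        connection coefficients \<open>?\<omega>\<close>.\<close>
      by (subst frame_expansion[OF p n]) (simp only: differential_sum[OF frame_tangent[OF _ p]])
    also have "\<dots> = (\<Sum>l = 1..DIM('e). h (u p) (\<lambda>d. ?\<omega> i l *\<^sub>R E l p d) (E j p))"
      by (rule B.metric_sum[OF B.tangent_scaleR[OF E_tangent[OF _ p]] E_tangent[OF j p]])
    also have "\<dots> = (\<Sum>l = 1..DIM('e). ?\<omega> i l * ?h l j)"
      by (rule sum.cong[OF refl]) (rule B.metric_scaleR(1)[OF E_tangent[OF _ p] E_tangent[OF j p]])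
    finally have "?D i j = (\<Sum>l = 1..DIM('e). ?\<omega> i l * ?h l j) + ?S i j"
      unfolding D_eq[OF i p v] B.metric_add(1)[OF differential_tangent[OF n]
          sff_tangent[OF p v frame_tangent[OF i p]] E_tangent[OF j p]]
      using B.metric_sym[OF E_tangent[OF j p] sff_tangent[OF p v frame_tangent[OF i p]]] by simp
    then show "?h i j * ?D i j = ?h i j * (\<Sum>l = 1..DIM('e). ?\<omega> i l * ?h l j) + ?h i j * ?S i j"
      by (simp only: distrib_left)
  qed
  also have "\<dots> = (\<Sum>i = 1..DIM('e). \<Sum>j = 1..DIM('e). ?h i j * ?S i j)"
  proof -
    let ?K = "\<Sum>i = 1..DIM('e). \<Sum>j = 1..DIM('e). ?h i j * (\<Sum>l = 1..DIM('e). ?\<omega> i l * ?h l j)"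
    let ?M = "\<lambda>i l. \<Sum>j = 1..DIM('e). ?h i j * ?h l j"
    have K: "?K = (\<Sum>i = 1..DIM('e). \<Sum>l = 1..DIM('e). ?\<omega> i l * ?M i l)"
      unfolding sum_distrib_left
      by (rule sum.cong[OF refl], subst sum.swap) (simp add: mult.left_commute)
    also have "\<dots> = (\<Sum>i = 1..DIM('e). \<Sum>l = 1..DIM('e). - (?\<omega> l i * ?M l i))"
    proof (intro sum.cong refl)
      fix i l assume i: "i \<in> {1..DIM('e)}" and l: "l \<in> {1..DIM('e)}"
      show "?\<omega> i l * ?M i l = - (?\<omega> l i * ?M l i)"
        unfolding frame_connection_antisym[OF p v i l] by (simp add: mult.commute)
    qed
    \<comment> \<open>After relabelling, the right side is minus the sum to which \<open>?K\<close>
      was rewritten, so \<open>?K\<close> is its own negative.\<close>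
    also have "\<dots> = - (\<Sum>l = 1..DIM('e). \<Sum>i = 1..DIM('e). ?\<omega> l i * ?M l i)"
      unfolding sum_negf by (subst sum.swap) simp
    finally have "?K = 0" unfolding K by simp
    then show ?thesis unfolding sum.distrib by simp
  qed
  finally show "dir_deriv A p v \<phi> = (\<Sum>i = 1..DIM('e). \<Sum>j = 1..DIM('e). ?h i j * ?S i j)" .
qed

text \<open>For \<open>F'\<close> only differentiability is recorded, because its derivative is
  carried along symbolically until it cancels.\<close>

lemma F_\<phi>_deriv:
  assumes p: "p \<in> U"
  shows "A.differentiable_fun p (\<lambda>q. F (\<phi> q))" "A.differentiable_fun p (\<lambda>q. F' (\<phi> q))"
    "v \<in> tangent_space A p \<Longrightarrow> dir_deriv A p v (\<lambda>q. F (\<phi> q)) = F' (\<phi> p) * dir_deriv A p v \<phi>"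
proof -
  have range: "range \<phi> \<subseteq> {0..}" using \<phi>_nonneg by auto
  note rF = A.dir_deriv_compose[OF \<phi>_deriv(1)[OF p] range F[OF \<phi>_nonneg]]
    and rF' = A.dir_deriv_compose[OF \<phi>_deriv(1)[OF p] range F'[OF \<phi>_nonneg]]
  show "A.differentiable_fun p (\<lambda>q. F (\<phi> q))" by (rule rF)
  show "A.differentiable_fun p (\<lambda>q. F' (\<phi> q))" by (rule rF')
  show "dir_deriv A p v (\<lambda>q. F (\<phi> q)) = F' (\<phi> p) * dir_deriv A p v \<phi>" if "v \<in> tangent_space A p"
    by (rule rF(2)[OF that])
qed

text \<open>The part of the derivative of \<open>\<langle>\<sigma>(w), du(z)\<rangle>\<close> along v that does not involve the derivatives of
  the fields extending w and z.\<close>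

definition Q :: "'p \<Rightarrow> ('p, 'e) tvec \<Rightarrow> ('p, 'e) tvec \<Rightarrow> ('p, 'e) tvec \<Rightarrow> real" where
  "Q p v w z = (\<Sum>j = 1..DIM('e).
    (h (u p) (sff p v w) (E j p) + h (u p) (du p w) (D p v j)) * h (u p) (E j p) (du p z) +
    h (u p) (du p w) (E j p) * (h (u p) (D p v j) (du p z) + h (u p) (E j p) (sff p v z)))"

text \<open>By the product rule, the terms containing derivatives of \<open>W\<close> and
  \<open>Z\<close> are exactly the two values of \<open>T\<close> that are subtracted. The remainder
  involves only \<open>W p\<close> and \<open>Z p\<close>, hence is independent of the
  extensions.\<close>

lemma stress_energy_deriv:
  assumes p: "p \<in> U" and v: "v \<in> tangent_space A p"
    and W: "smooth_field A S W" and Z: "smooth_field A S Z" and S: "p \<in> S"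
  shows "dir_deriv A p v (\<lambda>q. T q (W q) (Z q)) - T p (nabla A g p v W) (Z p) - T p (W p) (nabla A g p v Z) =
    dir_deriv A p v (\<lambda>q. F (\<phi> q)) * g p (W p) (Z p) -
    dir_deriv A p v (\<lambda>q. F' (\<phi> q)) *
      (\<Sum>j = 1..DIM('e). h (u p) (du p (W p)) (E j p) * h (u p) (E j p) (du p (Z p))) -
    F' (\<phi> p) * Q p v (W p) (Z p)"
proof -
  let ?a = "\<lambda>j q. h (u q) (du q (W q)) (E j q)" and ?b = "\<lambda>j q. h (u q) (E j q) (du q (Z q))"
  let ?f = "\<lambda>q. F (\<phi> q)" and ?f' = "\<lambda>q. F' (\<phi> q)" and ?g = "\<lambda>q. g q (W q) (Z q)"
  let ?s = "\<lambda>q. \<Sum>j = 1..DIM('e). ?a j q * ?b j q"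
  note dW = differential_section(1)[OF W S] and dZ = differential_section(1)[OF Z S]
  note Wp = A.smooth_field_tangent[OF W S] and Zp = A.smooth_field_tangent[OF Z S]
  note nW = nabla_tangent[OF v W S] and nZ = nabla_tangent[OF v Z S]
  note da = nabla_along_metric[OF dW E_section[OF _ p]] and db = nabla_along_metric[OF E_section[OF _ p] dZ]
  have dab: "A.differentiable_fun p (\<lambda>q. ?a j q * ?b j q)"
    "dir_deriv A p v (\<lambda>q. ?a j q * ?b j q) =
      dir_deriv A p v (?a j) * ?b j p + ?a j p * dir_deriv A p v (?b j)"
    if j: "j \<in> {1..DIM('e)}" for j
    by (rule A.dir_deriv_mult[OF da(1)[OF j] db(1)[OF j]])
      (rule A.dir_deriv_mult(2)[OF da(1)[OF j] db(1)[OF j] v])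
  have ds1: "A.differentiable_fun p ?s" by (rule A.dir_deriv_sum(1)[OF dab(1)])
  have ds2: "dir_deriv A p v ?s = (\<Sum>j = 1..DIM('e). dir_deriv A p v (\<lambda>q. ?a j q * ?b j q))"
    by (rule A.dir_deriv_sum(2)[OF dab(1) v])
  note dg = nabla_metric[OF W S Z S]
  note d1 = A.dir_deriv_mult[OF F_\<phi>_deriv(1)[OF p] dg(1)]
    and d2 = A.dir_deriv_mult[OF F_\<phi>_deriv(2)[OF p] ds1]
  note d = A.dir_deriv_diff[OF d1(1) d2(1)]
  have "open S" using W unfolding smooth_field_def by blast
  \<comment> \<open>The fields live on \<open>S\<close>, while the frame formula for
    \<open>T\<close> holds on \<open>U\<close>; the identity is differentiated on the
    overlap.\<close>
  then have near: "open (S \<inter> U)" "p \<in> S \<inter> U" using open_frame_domain S p by auto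
  have T: "?f q * ?g q - ?f' q * ?s q = T q (W q) (Z q)" if "q \<in> S \<inter> U" for q
    using stress_energy_eq[of q "Z q" "W q"] A.smooth_field_tangent[OF Z] that by auto
  have "dir_deriv A p v (\<lambda>q. T q (W q) (Z q)) = dir_deriv A p v (\<lambda>q. ?f q * ?g q - ?f' q * ?s q)"
    by (rule A.dir_deriv_cong(2)[OF near T d(1) v])
  also have "\<dots> = dir_deriv A p v ?f * ?g p + ?f p * dir_deriv A p v ?g -
      (dir_deriv A p v ?f' * ?s p + ?f' p * dir_deriv A p v ?s)"
    by (simp only: d(2)[OF v] d1(2)[OF v] d2(2)[OF v])
  also have "dir_deriv A p v ?s = (\<Sum>j = 1..DIM('e). dir_deriv A p v (?a j) * ?b j p + ?a j p * dir_deriv A p v (?b j))"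
    unfolding ds2 by (rule sum.cong[OF refl dab(2)])
  also have "\<dots> = (\<Sum>j = 1..DIM('e). h (u p) (du p (nabla A g p v W)) (E j p) * ?b j p) +
      (\<Sum>j = 1..DIM('e). ?a j p * h (u p) (E j p) (du p (nabla A g p v Z))) + Q p v (W p) (Z p)"
    unfolding Q_def sum.distrib[symmetric]
  proof (intro sum.cong refl)
    fix j assume j: "j \<in> {1..DIM('e)}"
    note EB = E_tangent[OF j p]
    note sW = sff_tangent[OF p v Wp] and sZ = sff_tangent[OF p v Zp]
    show "dir_deriv A p v (?a j) * ?b j p + ?a j p * dir_deriv A p v (?b j) =
      h (u p) (du p (nabla A g p v W)) (E j p) * ?b j p +
      ?a j p * h (u p) (E j p) (du p (nabla A g p v Z)) +
      ((h (u p) (sff p v (W p)) (E j p) + h (u p) (du p (W p)) (D p v j)) * ?b j p +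
       ?a j p * (h (u p) (D p v j) (du p (Z p)) + h (u p) (E j p) (sff p v (Z p))))"
      unfolding da(2)[OF j v] db(2)[OF j v] nabla_along_differential[OF v W S]
        nabla_along_differential[OF v Z S] B.metric_add(1)[OF differential_tangent[OF nW] sW EB]
        B.metric_add(2)[OF differential_tangent[OF nZ] sZ EB]
      by (simp add: algebra_simps)
  qed
  finally show ?thesis
    unfolding stress_energy_eq[OF p Zp] stress_energy_eq[OF p nZ] dg(2)[OF v] by (simp add: algebra_simps)
qed

text \<open>The preceding formula holds for every extension, so its value satisfies the description;
  the extensions by the frame show that no other number does.\<close>

lemma nabla_stress_energy:
  assumes p: "p \<in> U" and v: "v \<in> tangent_space A p"
    and w: "w \<in> tangent_space A p" and z: "z \<in> tangent_space A p"
  shows "nabla_tensor A g T p v w z =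
    dir_deriv A p v (\<lambda>q. F (\<phi> q)) * g p w z -
    dir_deriv A p v (\<lambda>q. F' (\<phi> q)) * (\<Sum>j = 1..DIM('e). h (u p) (du p w) (E j p) * h (u p) (E j p) (du p z)) -
    F' (\<phi> p) * Q p v w z" (is "_ = ?r")
  unfolding nabla_tensor_def
proof (rule the_equality)
  show "\<forall>S W Z. p \<in> S \<and> smooth_field A S W \<and> smooth_field A S Z \<and> W p = w \<and> Z p = z \<longrightarrow>
    ?r = dir_deriv A p v (\<lambda>q. T q (W q) (Z q)) - T p (nabla A g p v W) z - T p w (nabla A g p v Z)"
  proof (intro allI impI, elim conjE)
    fix S W Z assume "p \<in> S" "smooth_field A S W" "smooth_field A S Z" "W p = w" "Z p = z"
    then show "?r = dir_deriv A p v (\<lambda>q. T q (W q) (Z q)) - T p (nabla A g p v W) z - T p w (nabla A g p v Z)"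
      using stress_energy_deriv[OF p v, of S W Z] by simp
  qed
  fix r
  assume r: "\<forall>S W Z. p \<in> S \<and> smooth_field A S W \<and> smooth_field A S Z \<and> W p = w \<and> Z p = z \<longrightarrow>
    r = dir_deriv A p v (\<lambda>q. T q (W q) (Z q)) - T p (nabla A g p v W) z - T p w (nabla A g p v Z)"
  obtain W Z where WZ: "smooth_field A U W" "W p = w" "smooth_field A U Z" "Z p = z"
    using extension_exists[OF p w] extension_exists[OF p z] by blast
  then have "r = dir_deriv A p v (\<lambda>q. T q (W q) (Z q)) - T p (nabla A g p v W) z - T p w (nabla A g p v Z)"
    using r p by blast
  then show "r = ?r" using stress_energy_deriv[OF p v WZ(1,3) p] WZ(2,4) by simp
qed

text \<open>The value of \<open>sigma_F\<close> at the derivative of \<open>e i\<close> subtracted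
  in the divergence cancels the image of that derivative arising from the factor
  \<open>h (u p) (E i p) (E j p)\<close>. What remains has the shape of \<open>Q\<close>.\<close>

lemma metric_div_sigma:
  assumes p: "p \<in> U" and Y: "Y \<in> tangent_space B (u p)"
  shows "h (u p) (div_sigma_F A B g h u e F' p) Y = (\<Sum>i = 1..DIM('e). \<Sum>j = 1..DIM('e).
    dir_deriv A p (e i p) (\<lambda>q. F' (\<phi> q)) * (h (u p) (E i p) (E j p) * h (u p) (E j p) Y) +
    F' (\<phi> p) * ((h (u p) (sff p (e i p) (e i p)) (E j p) + h (u p) (E i p) (D p (e i p) j)) * h (u p) (E j p) Y +
      h (u p) (E i p) (E j p) * h (u p) (D p (e i p) j) Y))"
proof -
  let ?f' = "\<lambda>q. F' (\<phi> q)" and ?H = "\<lambda>i j q. h (u q) (E i q) (E j q)"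
  let ?N = "\<lambda>i. nabla A g p (e i p) (e i)"
  let ?V = "\<lambda>i. nabla_along A B h u p (e i p) (\<lambda>q. sigma_F A B h u e F' q (e i q))"
  let ?S = "\<lambda>i. sigma_F A B h u e F' p (?N i)"
  let ?c = "\<lambda>i j. dir_deriv A p (e i p) ?f' * ?H i j p + ?f' p * dir_deriv A p (e i p) (?H i j)"
  have sigma: "(\<lambda>q. sigma_F A B h u e F' q (e i q)) = (\<lambda>q d. \<Sum>j = 1..DIM('e). (?f' q * ?H i j q) *\<^sub>R E j q d)" for i
    unfolding sigma_F_def sigma_def by (simp add: scaleR_sum_right)
  have S: "?S i \<in> tangent_space B (u p)" for i
    unfolding sigma_F_def by (rule B.tangent_scaleR[OF sigma_metric(1)[OF p Y]])
  have V: "?V i \<in> tangent_space B (u p)"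
    "h (u p) (?V i) Y = (\<Sum>j = 1..DIM('e). ?c i j * h (u p) (E j p) Y + ?f' p * ?H i j p * h (u p) (D p (e i p) j) Y)"
    if i: "i \<in> {1..DIM('e)}" for i
  proof -
    note v = frame_tangent[OF i p]
    note dc = A.dir_deriv_mult[OF F_\<phi>_deriv(2)[OF p] E_metric_deriv(1)[OF p i]]
    have N1: "differentiable_section p (\<lambda>q d. \<Sum>j = 1..DIM('e). (?f' q * ?H i j q) *\<^sub>R E j q d)"
      by (rule nabla_along_sum(1)[OF finite_atLeastAtMost dc(1) E_section[OF _ p]])
    have N2: "nabla_along A B h u p (e i p) (\<lambda>q d. \<Sum>j = 1..DIM('e). (?f' q * ?H i j q) *\<^sub>R E j q d) =
        (\<lambda>d. \<Sum>j = 1..DIM('e). dir_deriv A p (e i p) (\<lambda>q. ?f' q * ?H i j q) *\<^sub>R E j p d +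
          (?f' p * ?H i j p) *\<^sub>R D p (e i p) j d)"
      by (rule nabla_along_sum(2)[OF finite_atLeastAtMost dc(1) E_section[OF _ p] v])
    show "?V i \<in> tangent_space B (u p)"
      unfolding sigma by (rule nabla_along_tangent[OF v N1])
    have "?V i = (\<lambda>d. \<Sum>j = 1..DIM('e). ?c i j *\<^sub>R E j p d + (?f' p * ?H i j p) *\<^sub>R D p (e i p) j d)"
      unfolding sigma N2 by (intro ext sum.cong refl) (simp only: dc(2)[OF _ v])
    then have "h (u p) (?V i) Y = h (u p) (\<lambda>d. \<Sum>j = 1..DIM('e). ?c i j *\<^sub>R E j p d + (?f' p * ?H i j p) *\<^sub>R D p (e i p) j d) Y"
      by (rule arg_cong)
    also have "\<dots> = (\<Sum>j = 1..DIM('e). h (u p) (\<lambda>d. ?c i j *\<^sub>R E j p d + (?f' p * ?H i j p) *\<^sub>R D p (e i p) j d) Y)"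
      by (rule B.metric_sum[OF _ Y]) (intro B.tangent_add B.tangent_scaleR E_tangent D_tangent p v)
    also have "\<dots> = (\<Sum>j = 1..DIM('e). ?c i j * h (u p) (E j p) Y + ?f' p * ?H i j p * h (u p) (D p (e i p) j) Y)"
    proof (intro sum.cong refl)
      fix j assume j: "j \<in> {1..DIM('e)}"
      note t = E_tangent[OF j p] D_tangent[OF j p v]
      show "h (u p) (\<lambda>d. ?c i j *\<^sub>R E j p d + (?f' p * ?H i j p) *\<^sub>R D p (e i p) j d) Y =
          ?c i j * h (u p) (E j p) Y + ?f' p * ?H i j p * h (u p) (D p (e i p) j) Y"
        unfolding B.metric_add(1)[OF B.tangent_scaleR[OF t(1)] B.tangent_scaleR[OF t(2)] Y]
          B.metric_scaleR(1)[OF t(1) Y] B.metric_scaleR(1)[OF t(2) Y] ..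
    qed
    finally show "h (u p) (?V i) Y = (\<Sum>j = 1..DIM('e). ?c i j * h (u p) (E j p) Y + ?f' p * ?H i j p * h (u p) (D p (e i p) j) Y)" .
  qed
  have hS: "h (u p) (?S i) Y = (\<Sum>j = 1..DIM('e). ?f' p * (h (u p) (du p (?N i)) (E j p) * h (u p) (E j p) Y))" for i
    unfolding sigma_F_def B.metric_scaleR(1)[OF sigma_metric(1)[OF p Y] Y] sigma_metric(2)[OF p Y] sum_distrib_left ..
  have "h (u p) (div_sigma_F A B g h u e F' p) Y = (\<Sum>i = 1..DIM('e). h (u p) (\<lambda>d. ?V i d - ?S i d) Y)"
    unfolding div_sigma_F_def by (rule B.metric_sum[OF B.tangent_diff[OF V(1) S] Y])
  also have "\<dots> = (\<Sum>i = 1..DIM('e). h (u p) (?V i) Y - h (u p) (?S i) Y)"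
    by (intro sum.cong refl) (rule B.metric_diff[OF V(1) S Y])
  also have "\<dots> = (\<Sum>i = 1..DIM('e). \<Sum>j = 1..DIM('e).
    dir_deriv A p (e i p) ?f' * (?H i j p * h (u p) (E j p) Y) +
    ?f' p * ((h (u p) (sff p (e i p) (e i p)) (E j p) + h (u p) (E i p) (D p (e i p) j)) * h (u p) (E j p) Y +
      ?H i j p * h (u p) (D p (e i p) j) Y))"
  proof (intro sum.cong refl)
    fix i assume i: "i \<in> {1..DIM('e)}"
    note v = frame_tangent[OF i p]
    note n = differential_tangent[OF nabla_tangent[OF v frame_field[OF i] p]] sff_tangent[OF p v v]
    show "h (u p) (?V i) Y - h (u p) (?S i) Y = (\<Sum>j = 1..DIM('e). dir_deriv A p (e i p) ?f' * (?H i j p * h (u p) (E j p) Y) +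
      ?f' p * ((h (u p) (sff p (e i p) (e i p)) (E j p) + h (u p) (E i p) (D p (e i p) j)) * h (u p) (E j p) Y +
      ?H i j p * h (u p) (D p (e i p) j) Y))"
      unfolding V(2)[OF i] hS sum_subtractf[symmetric]
    proof (intro sum.cong refl)
      fix j assume j: "j \<in> {1..DIM('e)}"
      \<comment> \<open>Only the derivative of \<open>E i\<close> is split; the one with index
        \<open>j\<close> also occurs in \<open>Q\<close> and is kept whole.\<close>
      have "dir_deriv A p (e i p) (?H i j) = h (u p) (du p (?N i)) (E j p) +
          h (u p) (sff p (e i p) (e i p)) (E j p) + h (u p) (E i p) (D p (e i p) j)"
        unfolding E_metric_deriv(2)[OF p i j v] unfolding D_eq[OF i p v]
          B.metric_add(1)[OF n E_tangent[OF j p]] ..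
      then show "?c i j * h (u p) (E j p) Y + ?f' p * ?H i j p * h (u p) (D p (e i p) j) Y -
          ?f' p * (h (u p) (du p (?N i)) (E j p) * h (u p) (E j p) Y) =
        dir_deriv A p (e i p) ?f' * (?H i j p * h (u p) (E j p) Y) +
        ?f' p * ((h (u p) (sff p (e i p) (e i p)) (E j p) + h (u p) (E i p) (D p (e i p) j)) * h (u p) (E j p) Y +
          ?H i j p * h (u p) (D p (e i p) j) Y)"
        by (simp add: algebra_simps)
    qed
  qed
  finally show ?thesis .
qed

lemma divergence_stress_energy:
  assumes p: "p \<in> U" and X: "X \<in> tangent_space A p"
  shows "divergence A g e T p X = - h (u p) (div_sigma_F A B g h u e F' p) (du p X)"
proof -
  let ?f' = "\<lambda>q. F' (\<phi> q)" and ?H = "\<lambda>i j. h (u p) (E i p) (E j p)" and ?Y = "du p X"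
  note Y = differential_tangent[OF X]
  \<comment> \<open>The metric part of the tensor contributes the derivatives of \<open>F\<close>
    along the frame weighted by the components of \<open>X\<close>, which add up to the derivative
    along \<open>X\<close>.\<close>
  have "(\<Sum>k = 1..DIM('e). dir_deriv A p (e k p) (\<lambda>q. F (\<phi> q)) * g p (e k p) X) =
      (\<Sum>k = 1..DIM('e). g p X (e k p) *\<^sub>R dir_deriv A p (e k p) (\<lambda>q. F (\<phi> q)))"
    by (rule sum.cong[OF refl]) (simp only: A.metric_sym[OF X frame_tangent[OF _ p]] real_scaleR_def mult.commute)
  also have "\<dots> = dir_deriv A p (\<lambda>c. \<Sum>k = 1..DIM('e). g p X (e k p) *\<^sub>R e k p c) (\<lambda>q. F (\<phi> q))"
    by (rule A.dir_deriv_linear[OF F_\<phi>_deriv(1)[OF p] frame_tangent[OF _ p], symmetric])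
  also have "\<dots> = F' (\<phi> p) * dir_deriv A p X \<phi>"
    unfolding frame_expansion[OF p X, symmetric] by (rule F_\<phi>_deriv(3)[OF p X])
  also have "\<dots> = (\<Sum>k = 1..DIM('e). \<Sum>j = 1..DIM('e). ?f' p * (?H k j * h (u p) (E j p) (sff p (e k p) X)))"
    \<comment> \<open>Symmetry turns the form at \<open>X\<close> and \<open>e k\<close> into the
      form at \<open>e k\<close> and \<open>X\<close>, as it appears in \<open>Q\<close>.\<close>
    unfolding \<phi>_deriv(2)[OF p X] second_fundamental_form_sym[of p X] sum_distrib_left ..
  finally have grad: "(\<Sum>k = 1..DIM('e). dir_deriv A p (e k p) (\<lambda>q. F (\<phi> q)) * g p (e k p) X) = \<dots>" .
  have "divergence A g e T p X = (\<Sum>k = 1..DIM('e). dir_deriv A p (e k p) (\<lambda>q. F (\<phi> q)) * g p (e k p) X -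
      (\<Sum>j = 1..DIM('e). dir_deriv A p (e k p) ?f' * (?H k j * h (u p) (E j p) ?Y)) - ?f' p * Q p (e k p) (e k p) X)"
    unfolding divergence_def sum_distrib_left[symmetric]
    by (intro sum.cong refl) (rule nabla_stress_energy[OF p frame_tangent[OF _ p] frame_tangent[OF _ p] X])
  also have "\<dots> = - h (u p) (div_sigma_F A B g h u e F' p) ?Y"
    unfolding metric_div_sigma[OF p Y] sum_subtractf grad Q_def sum_distrib_left sum_negf[symmetric]
    unfolding sum_subtractf[symmetric]
    \<comment> \<open>With all terms under one double sum, the cancellation is an identity for each
      pair of indices.\<close>
    by (intro sum.cong refl) (simp add: algebra_simps)
  finally show ?thesis .
qed

end

theorem proposition2p3:
  fixes A :: "('p::{t2_space, second_countable_topology}, 'e::euclidean_space) chart set"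
    and B :: "('q::{t2_space, second_countable_topology}, 'f::euclidean_space) chart set"
    and g :: "'p \<Rightarrow> ('p, 'e) tvec \<Rightarrow> ('p, 'e) tvec \<Rightarrow> real"
    and h :: "'q \<Rightarrow> ('q, 'f) tvec \<Rightarrow> ('q, 'f) tvec \<Rightarrow> real"
    and u :: "'p \<Rightarrow> 'q"
    and F F' F'' :: "real \<Rightarrow> real"
    and U :: "'p set" and e :: "nat \<Rightarrow> 'p \<Rightarrow> ('p, 'e) tvec"
    and x :: 'p and X :: "('p, 'e) tvec"
  assumes "smooth_manifold A" and "riemannian_metric A g"
    and "smooth_manifold B" and "riemannian_metric B h"
    and "smooth_map A B u"
    and "\<forall>t\<ge>0. F t \<ge> 0" and "F 0 = 0"
    and "\<forall>t\<ge>0. (F has_real_derivative F' t) (at t within {0..})"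
    and "\<forall>t\<ge>0. (F' has_real_derivative F'' t) (at t within {0..})"
    and "continuous_on {0..} F''"
    and "\<forall>t>0. F' t > 0"
    and "orthonormal_frame A g U e" and "x \<in> U"
    and "X \<in> tangent_space A x"
  shows "divergence A g e (stress_energy A B g h u e F F') x X =
    - h (u x) (div_sigma_F A B g h u e F' x) (differential A B u x X)"
proof -
  interpret stress_energy_frame A B g h u F F' F'' U e
  proof
    show "smooth_manifold A" "riemannian_metric A g" "smooth_manifold B" "riemannian_metric B h"
      "smooth_map A B u" "orthonormal_frame A g U e" by fact+
    show "(F has_real_derivative F' t) (at t within {0..})"
      "(F' has_real_derivative F'' t) (at t within {0..})" if "t \<ge> 0" for t
      using assms(8,9) that by blast+
  qed
  show ?thesis by (rule divergence_stress_energy) fact+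
qed

end
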